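(* Let $\Omega\subset\mathbb{R}$ be a finite union of closed bounded intervals, let $w>0$ be a positive continuous weight function on $\Omega$, let $0<\alpha<1$, $1\leq p\leq\infty$, $m\geq 2$ an integer, and let $F\in C(\Omega)$. Define $d:=\inf_{q\in W^{\alpha,p}(w,\Omega)}\|q-F\|_{\mathrm{L}^p(w,\Omega)}$. Then $$d=\inf_{q\in W^{m,p}(w,\Omega)}\|q-F\|_{\mathrm{L}^p(w,\Omega)}.$$
   Context: $\mathbb{C}^+=\{z\in\mathbb{C}:\Im z>0\}$. A Herglotz function is an analytic $h\colon\mathbb{C}^+\to\mathbb{C}$ with $\Im h\geq 0$; a quasi-Herglotz function is an analytic $q\colon\mathbb{C}^+\to\mathbb{C}$ with $q=h_1-h_2$ for Herglotz functions $h_1,h_2$. $C(\Omega)$ is the space of complex-valued continuous functions on $\Omega$. $\mathrm{L}^p(w,\Omega)$ is the Banach space with norm $\|f\|=(\int_\Omega w|f|^p\,\mathrm{d}x)^{1/p}$ for $p<\infty$, and the essential supremum of $w|f|$ for $p=\infty$. $C^{0,\alpha}(\Omega)$ is the space of complex-valued Hölder continuous functions with exponent $\alpha$ on $\Omega$. $W^{\alpha,p}(w,\Omega)\subset\mathrm{L}^p(w,\Omega)$ is the set of all complex-valued $q\in C^{0,\alpha}(\Omega)$ such that there exists a quasi-Herglotz function which has a Hölder continuous (exponent $\alpha$) extension to $\mathbb{C}^+\cup\overline{\mathcal{O}}$ for some open neighborhood $\mathcal{O}$ of $\Omega$, coinciding with $q$ on $\Omega$. $W^{m,p}(w,\Omega)\subset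 W^{\alpha,p}(w,\Omega)$ is the subset of those functions for which this quasi-Herglotz function can be written as $q(z)=a+bz+\int_\mathbb{R}\left(\frac{1}{\xi-z}-\frac{\xi}{1+\xi^2}\right)\mathrm{d}\beta(\xi)$ ($a,b\in\mathbb{R}$) with a signed Borel measure $\beta$ that is absolutely continuous with density $\beta'$ equal to a finite uniform B-spline expansion of order $m$, i.e. a finite linear combination of B-splines of order $m$ (compactly supported, piecewise polynomial of degree $m-1$, each defined by $m+1$ break-points) with equidistant break-points. *)

theory Defs
  imports "HOL-Analysis.Analysis" "HOL-Probability.Essential_Supremum"
begin

definition upper_half_plane :: "complex set" where
  "upper_half_plane = {z. Im z > 0}"

definition herglotz :: "(complex \<Rightarrow> complex) \<Rightarrow> bool" where
  "herglotz h \<longleftrightarrow> h holomorphic_on upper_half_plane \<and> (\<forall>z\<in>upper_half_plane. Im (h z) \<ge> 0)"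

definition quasi_herglotz :: "(complex \<Rightarrow> complex) \<Rightarrow> bool" where
  "quasi_herglotz q \<longleftrightarrow> q holomorphic_on upper_half_plane \<and>
     (\<exists>h1 h2. herglotz h1 \<and> herglotz h2 \<and> (\<forall>z\<in>upper_half_plane. q z = h1 z - h2 z))"

definition holder_on :: "real \<Rightarrow> 'a::metric_space set \<Rightarrow> ('a \<Rightarrow> 'b::metric_space) \<Rightarrow> bool" where
  "holder_on \<alpha> S f \<longleftrightarrow> (\<exists>C. \<forall>x\<in>S. \<forall>y\<in>S. dist (f x) (f y) \<le> C * dist x y powr \<alpha>)"

text \<open>Hoelder continuity on (possibly unbounded) sets, read locally: Hoelder on every compact subset.\<close>
definition loc_holder_on :: "real \<Rightarrow> 'a::metric_space set \<Rightarrow> ('a \<Rightarrow> 'b::metric_space) \<Rightarrow> bool" where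
  "loc_holder_on \<alpha> S f \<longleftrightarrow> (\<forall>K. compact K \<and> K \<subseteq> S \<longrightarrow> holder_on \<alpha> K f)"

definition finite_union_closed_intervals :: "real set \<Rightarrow> bool" where
  "finite_union_closed_intervals \<Omega> \<longleftrightarrow>
     (\<exists>I :: (real \<times> real) set. finite I \<and> (\<forall>(a,b)\<in>I. a < b) \<and> \<Omega> = (\<Union>(a,b)\<in>I. {a..b}))"

definition Lp_norm :: "ereal \<Rightarrow> (real \<Rightarrow> real) \<Rightarrow> real set \<Rightarrow> (real \<Rightarrow> complex) \<Rightarrow> real" where
  "Lp_norm p w \<Omega> f =
     (if p = \<infinity> then real_of_ereal (esssup (restrict_space lborel \<Omega>) (\<lambda>x. ereal (w x * cmod (f x))))
      else (LINT x:\<Omega>|lborel. w x * cmod (f x) powr real_of_ereal p) powr (1 / real_of_ereal p))"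

text \<open>Cardinal B-spline of order m (degree m-1), supported on [0,m], break-points 0,1,...,m.\<close>
fun cardinal_bspline :: "nat \<Rightarrow> real \<Rightarrow> real" where
  "cardinal_bspline 0 x = 0"
| "cardinal_bspline (Suc 0) x = (if 0 \<le> x \<and> x < 1 then 1 else 0)"
| "cardinal_bspline (Suc (Suc n)) x =
     (x * cardinal_bspline (Suc n) x + (real (Suc (Suc n)) - x) * cardinal_bspline (Suc n) (x - 1))
     / real (Suc n)"

definition uniform_bspline_expansion :: "nat \<Rightarrow> (real \<Rightarrow> real) \<Rightarrow> bool" where
  "uniform_bspline_expansion m g \<longleftrightarrow>
     (\<exists>h x0 (K::int set) (c::int \<Rightarrow> real). h > 0 \<and> finite K \<and>
        (\<forall>x. g x = (\<Sum>k\<in>K. c k * cardinal_bspline m ((x - x0) / h - real_of_int k))))"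

definition holder_qh_extension :: "real \<Rightarrow> real set \<Rightarrow> (real \<Rightarrow> complex) \<Rightarrow> (complex \<Rightarrow> complex) \<Rightarrow> bool" where
  "holder_qh_extension \<alpha> \<Omega> q Q \<longleftrightarrow> quasi_herglotz Q \<and>
     (\<exists>U E. open U \<and> \<Omega> \<subseteq> U \<and>
        loc_holder_on \<alpha> (upper_half_plane \<union> complex_of_real ` closure U) E \<and>
        (\<forall>z\<in>upper_half_plane. E z = Q z) \<and>
        (\<forall>x\<in>\<Omega>. E (complex_of_real x) = q x))"

definition W_alpha :: "real \<Rightarrow> real set \<Rightarrow> (real \<Rightarrow> complex) set" where
  "W_alpha \<alpha> \<Omega> = {q. holder_on \<alpha> \<Omega> q \<and> (\<exists>Q. holder_qh_extension \<alpha> \<Omega> q Q)}"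

definition W_m :: "nat \<Rightarrow> real \<Rightarrow> real set \<Rightarrow> (real \<Rightarrow> complex) set" where
  "W_m m \<alpha> \<Omega> = {q. holder_on \<alpha> \<Omega> q \<and> (\<exists>Q. holder_qh_extension \<alpha> \<Omega> q Q \<and>
      (\<exists>(a::real) (b::real) \<beta>'. uniform_bspline_expansion m \<beta>' \<and>
         (\<forall>z\<in>upper_half_plane. Q z = complex_of_real a + complex_of_real b * z +
            (LINT \<xi>|lborel. (1 / (complex_of_real \<xi> - z) - complex_of_real (\<xi> / (1 + \<xi>\<^sup>2)))
                             * complex_of_real (\<beta>' \<xi>)))))}"

end

theory Submission
  imports Defs "HOL-Complex_Analysis.Complex_Analysis"
begin

text \<open>
  Both infima are \<open>0\<close>, because the boundary values of the members of \<open>W\<^sup>m\<close> are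
  uniformly dense in \<open>C(\<Omega>)\<close>. For a compactly supported Lipschitz density \<open>g\<close> the Cauchy integral
  of \<open>g\<close> over the upper half plane is locally \<open>\<alpha>\<close>-Hoelder up to the real axis, and its boundary
  value has imaginary part \<open>\<pi> g\<close>. So a spline \<open>g\<close> that approximates \<open>Im F / \<pi>\<close> matches the
  imaginary part of \<open>F\<close>; it remains to correct the real part without disturbing the imaginary one.
  B-splines with support in \<open>[A, \<infinity>)\<close>, to the right of \<open>\<Omega>\<close>, do this: the Taylor expansion of their
  Cauchy integrals at \<open>0\<close> has coefficients \<open>a\<^sub>j = \<integral> g(\<xi>) \<xi>\<^sup>-\<^sup>j\<^sup>-\<^sup>1 d\<xi>\<close>, and the remainder after \<open>n\<close>
  terms is \<open>o(a\<^sub>n)\<close> as \<open>A \<rightarrow> \<infinity>\<close>. Inductively every monomial, hence by Weierstrass every real continuous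
  function on \<open>\<Omega>\<close>, is a uniform limit of such boundary values, with a mesh size fixed in advance.
\<close>

section \<open>Cardinal B-splines\<close>

lemma cardinal_bspline_rec:
  assumes "m \<ge> 1"
  shows "cardinal_bspline (Suc m) x =
    (x * cardinal_bspline m x + (real (Suc m) - x) * cardinal_bspline m (x - 1)) / real m"
  using assms by (cases m) auto

lemma cardinal_bspline_eq_0:
  assumes "m \<ge> 1" "x < 0 \<or> real m \<le> x"
  shows "cardinal_bspline m x = 0"
  using assms
proof (induction m arbitrary: x rule: nat_induct_at_least)
  case base
  then show ?case by auto
next
  case (Suc n)
  have "cardinal_bspline n x = 0" using Suc.IH[of x] Suc.prems by auto
  moreover have "cardinal_bspline n (x - 1) = 0" using Suc.IH[of "x - 1"] Suc.prems by auto
  ultimately show ?case using cardinal_bspline_rec[OF Suc.hyps] by simp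
qed

text \<open>A factor of the recurrence is negative only where the spline that it multiplies
  vanishes.\<close>

lemma cardinal_bspline_nonneg:
  assumes "m \<ge> 1"
  shows "cardinal_bspline m x \<ge> 0"
  using assms
proof (induction m arbitrary: x rule: nat_induct_at_least)
  case base
  then show ?case by auto
next
  case (Suc n)
  have "x * cardinal_bspline n x \<ge> 0"
    using Suc.IH[of x] cardinal_bspline_eq_0[OF Suc.hyps, of x] by (cases "x < 0") auto
  moreover have "(real (Suc n) - x) * cardinal_bspline n (x - 1) \<ge> 0"
    using Suc.IH[of "x - 1"] cardinal_bspline_eq_0[OF Suc.hyps, of "x - 1"]
    by (cases "real n \<le> x - 1") auto
  ultimately show ?case using cardinal_bspline_rec[OF Suc.hyps] by simp
qed

text \<open>The bounds on \<open>i\<close> and \<open>j\<close> make the window contain every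
  translate that is nonzero at \<open>x\<close>. In the recurrence the second sum is shifted by one
  index; the factors \<open>x - k\<close> and \<open>n - (x - k)\<close> then add up to
  \<open>n\<close>, which reduces order \<open>n + 1\<close> to order \<open>n\<close>.\<close>

lemma cardinal_bspline_partition_of_unity:
  assumes "m \<ge> 1" "of_int i \<le> x - real m" "x \<le> of_int j"
  shows "(\<Sum>k\<in>{i..j}. cardinal_bspline m (x - of_int k)) = 1"
  using assms
proof (induction m arbitrary: i j rule: nat_induct_at_least)
  case base
  have "{i..j} = insert \<lfloor>x\<rfloor> ({i..j} - {\<lfloor>x\<rfloor>})" using base by (auto simp: le_floor_iff floor_le_iff)
  moreover have "(\<Sum>k\<in>insert \<lfloor>x\<rfloor> ({i..j} - {\<lfloor>x\<rfloor>}). cardinal_bspline 1 (x - of_int k)) = 1 + 0"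
  proof (subst sum.insert_remove, simp, rule arg_cong2[of _ _ _ _ "(+)"])
    show "cardinal_bspline 1 (x - real_of_int \<lfloor>x\<rfloor>) = 1" by (auto, linarith+)
    show "(\<Sum>k\<in>{i..j} - {\<lfloor>x\<rfloor>} - {\<lfloor>x\<rfloor>}. cardinal_bspline 1 (x - of_int k)) = 0"
      by (rule sum.neutral) (auto, linarith)
  qed
  ultimately show ?case by simp
next
  case (Suc n)
  let ?B = "cardinal_bspline n"
  have n: "real n > 0" using Suc.hyps by simp
  \<comment> \<open>Both sums are brought to the common window \<open>{i..j+1}\<close>; the terms
    added at its ends are zero by the support of \<open>?B\<close>.\<close>
  have 1: "(\<Sum>k\<in>{i..j}. (x - of_int k) * ?B (x - of_int k)) =
      (\<Sum>k\<in>{i..j+1}. (x - of_int k) * ?B (x - of_int k))"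
    using Suc.prems Suc.hyps by (intro sum.mono_neutral_left) (auto intro!: cardinal_bspline_eq_0)
  have 2: "(\<Sum>k\<in>{i..j}. (real (Suc n) - (x - of_int k)) * ?B (x - of_int k - 1)) =
      (\<Sum>k\<in>{i+1..j+1}. (real n - (x - of_int k)) * ?B (x - of_int k))"
    by (rule sum.reindex_bij_witness[of _ "\<lambda>k. k - 1" "\<lambda>k. k + 1"]) (auto simp: algebra_simps)
  also have "\<dots> = (\<Sum>k\<in>{i..j+1}. (real n - (x - of_int k)) * ?B (x - of_int k))"
    using Suc.prems Suc.hyps by (intro sum.mono_neutral_left) (auto intro!: cardinal_bspline_eq_0)
  finally have 3: "(\<Sum>k\<in>{i..j}. (real (Suc n) - (x - of_int k)) * ?B (x - of_int k - 1)) = \<dots>" .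
  have "(\<Sum>k\<in>{i..j}. cardinal_bspline (Suc n) (x - of_int k)) =
     ((\<Sum>k\<in>{i..j}. (x - of_int k) * ?B (x - of_int k)) +
      (\<Sum>k\<in>{i..j}. (real (Suc n) - (x - of_int k)) * ?B (x - of_int k - 1))) / real n"
    by (simp only: cardinal_bspline_rec[OF Suc.hyps] sum.distrib sum_divide_distrib[symmetric])
  also have "\<dots> = (\<Sum>k\<in>{i..j+1}. real n * ?B (x - of_int k)) / real n"
    unfolding 1 3 by (simp add: sum.distrib[symmetric] algebra_simps)
  also have "\<dots> = (\<Sum>k\<in>{i..j+1}. ?B (x - of_int k))"
    using n by (simp add: sum_distrib_left[symmetric])
  also have "\<dots> = 1" using Suc.prems by (intro Suc.IH) auto
  finally show ?case .
qed

section \<open>Lipschitz continuity of the B-splines of order at least 2\<close>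

lemma lipschitz_times_id:
  fixes f :: "real \<Rightarrow> real"
  assumes L: "L-lipschitz_on UNIV f" and f: "\<And>x. \<bar>x\<bar> > c \<Longrightarrow> f x = 0" and "c \<ge> 0"
  shows "\<exists>L'. L'-lipschitz_on UNIV (\<lambda>x. x * f x)"
proof -
  have L0: "L \<ge> 0" and lip: "\<And>x y. \<bar>f x - f y\<bar> \<le> L * \<bar>x - y\<bar>"
    using L by (auto simp: lipschitz_on_def dist_real_def)
  \<comment> \<open>\<open>D\<close> bounds the absolute value of \<open>f\<close>: every point of
    \<open>[-c, c]\<close> is at distance at most \<open>2 * c + 1\<close> from the zero
    \<open>c + 1\<close> of \<open>f\<close>.\<close>
  define D where "D = L * (2 * c + 1)"
  have D0: "D \<ge> 0" using L0 \<open>c \<ge> 0\<close> by (simp add: D_def)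
  have bd: "\<bar>f y\<bar> \<le> D" for y
  proof (cases "\<bar>y\<bar> > c")
    case False
    have "\<bar>f y\<bar> = \<bar>f y - f (c + 1)\<bar>" using f[of "c + 1"] \<open>c \<ge> 0\<close> by simp
    also have "\<dots> \<le> L * \<bar>y - (c + 1)\<bar>" by (rule lip)
    also have "\<dots> \<le> D" unfolding D_def using False L0 by (intro mult_left_mono) auto
    finally show ?thesis .
  qed (use f D0 in auto)
  \<comment> \<open>The unbounded factor is evaluated at the point of \<open>[-c, c]\<close>; when
    only one of the two points lies there, that one takes the role of \<open>x\<close>.\<close>
  have close: "\<bar>x * f x - y * f y\<bar> \<le> (c * L + D) * \<bar>x - y\<bar>" if "\<bar>x\<bar> \<le> c" for x y
  proof -
    have "\<bar>x * f x - y * f y\<bar> = \<bar>x * (f x - f y) + (x - y) * f y\<bar>" by (simp add: algebra_simps)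
    also have "\<dots> \<le> \<bar>x\<bar> * \<bar>f x - f y\<bar> + \<bar>x - y\<bar> * \<bar>f y\<bar>"
      by (metis abs_triangle_ineq abs_mult)
    also have "\<dots> \<le> c * (L * \<bar>x - y\<bar>) + \<bar>x - y\<bar> * D"
      using that bd[of y] lip[of x y] \<open>c \<ge> 0\<close> by (intro add_mono mult_mono mult_left_mono) auto
    finally show ?thesis by (simp add: algebra_simps)
  qed
  have "\<bar>x * f x - y * f y\<bar> \<le> (c * L + D) * \<bar>x - y\<bar>" for x y
    using close[of x y] close[of y x] f[of x] f[of y] D0 L0 \<open>c \<ge> 0\<close>
    by (cases "\<bar>x\<bar> \<le> c"; cases "\<bar>y\<bar> \<le> c") (auto simp: abs_minus_commute)
  then have "(c * L + D)-lipschitz_on UNIV (\<lambda>x. x * f x)"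
    using D0 L0 \<open>c \<ge> 0\<close> by (auto simp: lipschitz_on_def dist_real_def)
  then show ?thesis ..
qed

lemma lipschitz_on_affine:
  fixes f :: "real \<Rightarrow> real"
  assumes "L-lipschitz_on UNIV f"
  shows "(L * \<bar>a\<bar>)-lipschitz_on UNIV (\<lambda>x. f (a * x + b))"
proof -
  have L0: "L \<ge> 0" and lip: "\<And>x y. \<bar>f x - f y\<bar> \<le> L * \<bar>x - y\<bar>"
    using assms by (auto simp: lipschitz_on_def dist_real_def)
  have "\<bar>f (a * x + b) - f (a * y + b)\<bar> \<le> L * \<bar>a\<bar> * \<bar>x - y\<bar>" for x y
    using lip[of "a * x + b" "a * y + b"] by (simp add: abs_mult right_diff_distrib[symmetric] mult.assoc)
  with L0 show ?thesis by (auto simp: lipschitz_on_def dist_real_def)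
qed

lemma cardinal_bspline_2: "cardinal_bspline 2 x = max 0 (min x (2 - x))"
  by (auto simp: numeral_2_eq_2)

text \<open>The induction starts at the hat function of order 2, because order 1 has jumps. In the
  recurrence \<open>n + 1 - x\<close> is read as \<open>n - (x - 1)\<close>, so the next spline is a
  combination of \<open>x * B x\<close> and of the translates by 1 of \<open>B x\<close> and
  \<open>x * B x\<close>, where \<open>B\<close> is the previous spline.\<close>

lemma cardinal_bspline_lipschitz:
  assumes "m \<ge> 2"
  shows "\<exists>L. L-lipschitz_on UNIV (cardinal_bspline m)"
  using assms
proof (induction m rule: nat_induct_at_least)
  case base
  have "1-lipschitz_on UNIV (cardinal_bspline 2)"
    by (auto simp: lipschitz_on_def dist_real_def cardinal_bspline_2)
  then show ?case ..
next
  case (Suc n)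
  let ?B = "cardinal_bspline n"
  have n1: "n \<ge> 1" using Suc.hyps by simp
  obtain L where L: "L-lipschitz_on UNIV ?B" using Suc.IH ..
  have *: "?B x = 0" if "\<bar>x\<bar> > real n" for x
    using cardinal_bspline_eq_0[OF n1, of x] that by (cases "x < 0") auto
  obtain L' where L': "L'-lipschitz_on UNIV (\<lambda>x. x * ?B x)"
    using lipschitz_times_id[OF L, of "real n"] * by auto
  have "\<exists>C. C-lipschitz_on UNIV (\<lambda>x. (1 / real n) *\<^sub>R (x * ?B x +
      (real n *\<^sub>R ?B (1 * x + - 1) - (1 * x + - 1) * ?B (1 * x + - 1))))"
    using lipschitz_on_cmult[OF lipschitz_on_add[OF L' lipschitz_on_diff[OF
      lipschitz_on_cmult[OF lipschitz_on_affine[OF L, of 1 "-1"]] lipschitz_on_affine[OF L', of 1 "-1"]]]]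
    by blast
  also have "(\<lambda>x. (1 / real n) *\<^sub>R (x * ?B x +
      (real n *\<^sub>R ?B (1 * x + - 1) - (1 * x + - 1) * ?B (1 * x + - 1)))) = cardinal_bspline (Suc n)"
    by (rule ext) (simp add: cardinal_bspline_rec[OF n1] field_simps)
  finally show ?case .
qed

section \<open>Cauchy integrals on the upper half plane\<close>

text \<open>The kernel omits the term \<open>\<xi> / (1 + \<xi>\<^sup>2)\<close> of the Herglotz
  representation: against a continuous density of compact support that term integrates to a real
  constant.\<close>

definition cauchy_int :: "(real \<Rightarrow> real) \<Rightarrow> complex \<Rightarrow> complex" where
  "cauchy_int g z = (LINT \<xi>|lborel. complex_of_real (g \<xi>) / (complex_of_real \<xi> - z))"

lemma compact_support_integral:
  fixes f :: "real \<Rightarrow> 'a::euclidean_space"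
  assumes "continuous_on {a..b} f" and f: "\<And>x. x \<notin> {a..b} \<Longrightarrow> f x = 0"
  shows "integrable lborel f" and "integral\<^sup>L lborel f = integral {a..b} f"
proof -
  have *: "set_integrable lborel {a..b} f" by (rule borel_integrable_atLeastAtMost'[OF assms(1)])
  have eq: "(\<lambda>x. indicator {a..b} x *\<^sub>R f x) = f" by (rule ext) (simp add: f indicator_def)
  show "integrable lborel f" using * unfolding set_integrable_def eq .
  show "integral\<^sup>L lborel f = integral {a..b} f"
    using set_borel_integral_eq_integral(2)[OF *] unfolding set_lebesgue_integral_def eq .
qed

lemma of_real_diff_nonzero: "Im z \<noteq> 0 \<Longrightarrow> complex_of_real x - z \<noteq> 0"
  by (auto simp: complex_eq_iff)

lemma
  assumes "continuous_on {-R..R} g" "\<And>x. \<bar>x\<bar> > R \<Longrightarrow> g x = 0" "Im z \<noteq> 0"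
  shows cauchy_int_integrable: "integrable lborel (\<lambda>\<xi>. complex_of_real (g \<xi>) / (complex_of_real \<xi> - z))"
    and cauchy_int_eq: "cauchy_int g z = integral {-R..R} (\<lambda>\<xi>. complex_of_real (g \<xi>) / (complex_of_real \<xi> - z))"
proof -
  have *: "continuous_on {-R..R} (\<lambda>\<xi>. complex_of_real (g \<xi>) / (complex_of_real \<xi> - z))"
    using assms of_real_diff_nonzero by (intro continuous_intros) auto
  have **: "complex_of_real (g \<xi>) / (complex_of_real \<xi> - z) = 0" if "\<xi> \<notin> {-R..R}" for \<xi>
    using assms(2)[of \<xi>] that by force
  show "integrable lborel (\<lambda>\<xi>. complex_of_real (g \<xi>) / (complex_of_real \<xi> - z))"
    by (rule compact_support_integral[OF * **])
  show "cauchy_int g z = integral {-R..R} (\<lambda>\<xi>. complex_of_real (g \<xi>) / (complex_of_real \<xi> - z))"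
    unfolding cauchy_int_def by (rule compact_support_integral[OF * **])
qed

lemma cauchy_int_holomorphic:
  assumes "continuous_on {-R..R} g" "\<And>x. \<bar>x\<bar> > R \<Longrightarrow> g x = 0"
  shows "cauchy_int g holomorphic_on upper_half_plane"
proof -
  have "(\<lambda>z. integral (cbox (-R) R) (\<lambda>\<xi>. complex_of_real (g \<xi>) / (complex_of_real \<xi> - z)))
        holomorphic_on upper_half_plane"
  proof (rule leibniz_rule_holomorphic)
    fix z \<xi> assume z: "z \<in> upper_half_plane"
    then have "complex_of_real \<xi> - z \<noteq> 0"
      by (intro of_real_diff_nonzero) (auto simp: upper_half_plane_def)
    then show "((\<lambda>z. complex_of_real (g \<xi>) / (complex_of_real \<xi> - z)) has_field_derivative
      complex_of_real (g \<xi>) / (complex_of_real \<xi> - z)^2) (at z within upper_half_plane)"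
      by (auto intro!: derivative_eq_intros simp: power2_eq_square)
  next
    fix z assume "z \<in> upper_half_plane"
    then have nz: "complex_of_real \<xi> - z \<noteq> 0" for \<xi>
      by (intro of_real_diff_nonzero) (auto simp: upper_half_plane_def)
    have "continuous_on {-R..R} (\<lambda>\<xi>. complex_of_real (g \<xi>) / (complex_of_real \<xi> - z))"
      by (intro continuous_intros assms(1) ballI nz)
    then show "(\<lambda>\<xi>. complex_of_real (g \<xi>) / (complex_of_real \<xi> - z)) integrable_on cbox (- R) R"
      unfolding cbox_interval by (rule integrable_continuous_real)
  next
    have *: "continuous_on (upper_half_plane \<times> cbox (-R) R) (\<lambda>x. g (snd x))"
      by (rule continuous_on_compose2[OF assms(1)]) (auto intro!: continuous_intros)
    have "continuous_on (upper_half_plane \<times> cbox (-R) R)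
      (\<lambda>x. complex_of_real (g (snd x)) / (complex_of_real (snd x) - fst x)\<^sup>2)"
      by (intro continuous_intros * ballI) (auto simp: upper_half_plane_def)
    then show "continuous_on (upper_half_plane \<times> cbox (-R) R)
      (\<lambda>(z, \<xi>). complex_of_real (g \<xi>) / (complex_of_real \<xi> - z)\<^sup>2)"
      by (simp add: case_prod_unfold)
  next
    show "convex upper_half_plane" unfolding upper_half_plane_def by (rule convex_halfspace_Im_gt)
  qed
  then show ?thesis
    by (rule holomorphic_transform)
      (use cauchy_int_eq[OF assms] in \<open>auto simp: upper_half_plane_def\<close>)
qed

text \<open>For \<open>Im z > 0\<close> the kernel \<open>1 / (\<xi> - z)\<close> has positive
  imaginary part, and a nonnegative density preserves the sign.\<close>

lemma cauchy_int_herglotz: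
  assumes "continuous_on {-R..R} g" "\<And>x. \<bar>x\<bar> > R \<Longrightarrow> g x = 0" "\<And>x. g x \<ge> 0"
  shows "herglotz (cauchy_int g)"
  unfolding herglotz_def
proof (intro conjI ballI cauchy_int_holomorphic[OF assms(1,2)])
  fix z assume "z \<in> upper_half_plane"
  then have z: "Im z > 0" by (simp add: upper_half_plane_def)
  have "Im (cauchy_int g z) = (LINT \<xi>|lborel. Im (complex_of_real (g \<xi>) / (complex_of_real \<xi> - z)))"
    unfolding cauchy_int_def using z
    by (subst integral_Im[symmetric]) (auto intro: cauchy_int_integrable[OF assms(1,2)])
  also have "\<dots> \<ge> 0"
    using z assms(3) by (intro Bochner_Integration.integral_nonneg) (auto simp: Im_divide)
  finally show "Im (cauchy_int g z) \<ge> 0" .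
qed

lemma cauchy_int_lincomb:
  assumes "continuous_on {-R..R} g" "\<And>x. \<bar>x\<bar> > R \<Longrightarrow> g x = 0"
      and "continuous_on {-R..R} g'" "\<And>x. \<bar>x\<bar> > R \<Longrightarrow> g' x = 0" "Im z \<noteq> 0"
  shows "cauchy_int (\<lambda>x. c * g x + c' * g' x) z = of_real c * cauchy_int g z + of_real c' * cauchy_int g' z"
proof -
  have "cauchy_int (\<lambda>x. c * g x + c' * g' x) z =
    (LINT \<xi>|lborel. of_real c * (complex_of_real (g \<xi>) / (complex_of_real \<xi> - z)) +
                    of_real c' * (complex_of_real (g' \<xi>) / (complex_of_real \<xi> - z)))"
    unfolding cauchy_int_def by (simp add: add_divide_distrib)
  also have "\<dots> = of_real c * cauchy_int g z + of_real c' * cauchy_int g' z"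
    unfolding cauchy_int_def
    using cauchy_int_integrable[OF assms(1,2,5)] cauchy_int_integrable[OF assms(3,4,5)]
    by (subst Bochner_Integration.integral_add) (simp_all only: integrable_mult_right integral_mult_right_zero)
  finally show ?thesis .
qed

text \<open>The positive and the negative part of \<open>g\<close> inherit continuity and support;
  their Cauchy integrals serve as the two Herglotz functions.\<close>

lemma cauchy_int_quasi_herglotz:
  assumes "continuous_on {-R..R} g" "\<And>x. \<bar>x\<bar> > R \<Longrightarrow> g x = 0"
  shows "quasi_herglotz (cauchy_int g)"
proof -
  have c: "continuous_on {-R..R} (\<lambda>x. max 0 (g x))" "continuous_on {-R..R} (\<lambda>x. max 0 (- g x))"
    using assms(1) by (intro continuous_intros; simp)+
  have "cauchy_int g z = cauchy_int (\<lambda>x. max 0 (g x)) z - cauchy_int (\<lambda>x. max 0 (- g x)) z"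
    if "z \<in> upper_half_plane" for z
  proof -
    have "g = (\<lambda>x. 1 * max 0 (g x) + (-1) * max 0 (- g x))" by (rule ext) simp
    then have "cauchy_int g z = cauchy_int (\<lambda>x. 1 * max 0 (g x) + (-1) * max 0 (- g x)) z" by simp
    also have "\<dots> = of_real 1 * cauchy_int (\<lambda>x. max 0 (g x)) z + of_real (-1) * cauchy_int (\<lambda>x. max 0 (- g x)) z"
      using c assms(2) that by (intro cauchy_int_lincomb[of R]) (auto simp: upper_half_plane_def)
    finally show ?thesis by simp
  qed
  then show ?thesis
    unfolding quasi_herglotz_def
    using cauchy_int_herglotz[OF c(1)] cauchy_int_herglotz[OF c(2)] assms(2) cauchy_int_holomorphic[OF assms]
    by (intro conjI exI[of _ "cauchy_int (\<lambda>x. max 0 (g x))"] exI[of _ "cauchy_int (\<lambda>x. max 0 (- g x))"]) auto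
qed

section \<open>Integrals with a power singularity\<close>

lemma has_integral_abs_powr:
  fixes x R \<alpha> :: real
  assumes "\<alpha> < 1" "\<bar>x\<bar> \<le> R"
  shows "((\<lambda>\<xi>. \<bar>\<xi> - x\<bar> powr - \<alpha>) has_integral
     ((R - x) powr (1 - \<alpha>) + (R + x) powr (1 - \<alpha>)) / (1 - \<alpha>)) {-R..R}"
proof -
  \<comment> \<open>\<open>\<phi>\<close> is an antiderivative on either side of \<open>x\<close>,
    with \<open>max 0\<close> selecting the branch; it is continuous across \<open>x\<close> because
    \<open>1 - \<alpha> > 0\<close>, so \<open>x\<close> may be the exceptional point of the
    fundamental theorem.\<close>
  define \<phi> where "\<phi> \<xi> = (max 0 (\<xi> - x) powr (1 - \<alpha>) - max 0 (x - \<xi>) powr (1 - \<alpha>)) / (1 - \<alpha>)" for \<xi>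
  have "((\<lambda>\<xi>. \<bar>\<xi> - x\<bar> powr - \<alpha>) has_integral (\<phi> R - \<phi> (-R))) {-R..R}"
  proof (rule fundamental_theorem_of_calculus_strong[of "{x}"])
    show "continuous_on {-R..R} \<phi>"
      unfolding \<phi>_def using assms by (intro continuous_intros continuous_on_powr') auto
  next
    fix \<xi> assume \<xi>: "\<xi> \<in> {-R..R} - {x}"
    have "(\<phi> has_field_derivative \<bar>\<xi> - x\<bar> powr - \<alpha>) (at \<xi>)"
    proof (cases "\<xi> > x")
      case True
      have "((\<lambda>\<xi>. (\<xi> - x) powr (1 - \<alpha>) / (1 - \<alpha>)) has_field_derivative \<bar>\<xi> - x\<bar> powr - \<alpha>) (at \<xi>)"
        using True assms by (auto intro!: derivative_eq_intros)
      then show ?thesis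
        by (rule has_field_derivative_transform_within_open[of _ _ _ "{x<..}"])
          (use True in \<open>auto simp: \<phi>_def\<close>)
    next
      case False
      then have lt: "\<xi> < x" using \<xi> by auto
      have "((\<lambda>\<xi>. - ((x - \<xi>) powr (1 - \<alpha>)) / (1 - \<alpha>)) has_field_derivative \<bar>\<xi> - x\<bar> powr - \<alpha>) (at \<xi>)"
        using lt assms by (auto intro!: derivative_eq_intros)
      then show ?thesis
        by (rule has_field_derivative_transform_within_open[of _ _ _ "{..<x}"])
          (use lt in \<open>auto simp: \<phi>_def\<close>)
    qed
    then show "(\<phi> has_vector_derivative \<bar>\<xi> - x\<bar> powr - \<alpha>) (at \<xi>)"
      by (simp add: has_real_derivative_iff_has_vector_derivative)
  qed (use assms in auto)
  also have "\<phi> R - \<phi> (-R) = ((R - x) powr (1 - \<alpha>) + (R + x) powr (1 - \<alpha>)) / (1 - \<alpha>)"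
    using assms by (auto simp: \<phi>_def diff_divide_distrib add_divide_distrib add.commute)
  finally show ?thesis .
qed

text \<open>The bound does not depend on the position \<open>x\<close> of the singularity, which
  makes the later estimates uniform; it comes from \<open>R - x\<close> and \<open>R + x\<close>
  being at most \<open>2 * R\<close>.\<close>

lemma norm_integral_le_abs_powr:
  fixes f :: "real \<Rightarrow> complex"
  assumes "\<alpha> < 1" "\<bar>x\<bar> \<le> R" "K \<ge> 0" "f integrable_on {-R..R}"
    and f: "\<And>\<xi>. \<xi> \<noteq> x \<Longrightarrow> norm (f \<xi>) \<le> K * \<bar>\<xi> - x\<bar> powr - \<alpha>"
  shows "norm (integral {-R..R} f) \<le> K * (2 * (2 * R) powr (1 - \<alpha>) / (1 - \<alpha>))"
proof -
  \<comment> \<open>\<open>0 powr - \<alpha>\<close> is \<open>0\<close>, so the majorant vanishes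
    at \<open>x\<close>, where nothing is assumed about \<open>f\<close>. Replacing the integrand by
    \<open>0\<close> at this one point leaves the integral unchanged.\<close>
  define f' where "f' = (\<lambda>\<xi>. if \<xi> = x then 0 else f \<xi>)"
  let ?I = "((R - x) powr (1 - \<alpha>) + (R + x) powr (1 - \<alpha>)) / (1 - \<alpha>)"
  have "f' integrable_on {-R..R}"
    by (rule integrable_spike[OF assms(4), of "{x}"]) (auto simp: f'_def)
  have *: "((\<lambda>\<xi>. K * \<bar>\<xi> - x\<bar> powr - \<alpha>) has_integral K * ?I) {-R..R}"
    by (intro has_integral_mult_right has_integral_abs_powr assms)
  have "integral {-R..R} f = integral {-R..R} f'"
    by (rule integral_spike[of "{x}"]) (auto simp: f'_def)
  also have "norm \<dots> \<le> integral {-R..R} (\<lambda>\<xi>. K * \<bar>\<xi> - x\<bar> powr - \<alpha>)"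
    using * f by (intro Henstock_Kurzweil_Integration.integral_norm_bound_integral \<open>f' integrable_on _\<close>)
      (auto simp: f'_def integrable_on_def)
  also have "\<dots> = K * ?I" using * by (rule integral_unique)
  also have "\<dots> \<le> K * (((2 * R) powr (1 - \<alpha>) + (2 * R) powr (1 - \<alpha>)) / (1 - \<alpha>))"
    using assms by (intro mult_left_mono divide_right_mono add_mono powr_mono2) auto
  finally show ?thesis by simp
qed

section \<open>Hoelder estimates\<close>

text \<open>Subtracting the value of \<open>g\<close> below \<open>z\<close> keeps the integrand bounded; the part removed is a logarithm.\<close>

definition regularized_cauchy_int :: "real \<Rightarrow> (real \<Rightarrow> real) \<Rightarrow> complex \<Rightarrow> complex" where
  "regularized_cauchy_int R g z = integral {-R..R} (\<lambda>\<xi>. complex_of_real (g \<xi> - g (Re z)) / (complex_of_real \<xi> - z))"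

lemma regularized_cauchy_int_integrable:
  assumes "continuous_on {-R..R} g" "Im z \<noteq> 0"
  shows "(\<lambda>\<xi>. complex_of_real (g \<xi> - g (Re z)) / (complex_of_real \<xi> - z)) integrable_on {-R..R}"
  by (intro integrable_continuous_real continuous_intros assms(1) ballI of_real_diff_nonzero assms(2))

text \<open>
  Both points only have to be off the real axis: with \<open>z' = cnj z\<close> the estimate shows that the
  imaginary part vanishes at the boundary. Pointwise, the difference of the integrands is at most
  \<open>2 M min(1, |z - z'| / |\<xi> - z'|)\<close>.
\<close>

lemma regularized_cauchy_int_holder:
  assumes g: "M-lipschitz_on UNIV g" and \<alpha>: "0 < \<alpha>" "\<alpha> < 1"
    and z: "Im z \<noteq> 0" and z': "Im z' \<noteq> 0" "\<bar>Re z'\<bar> \<le> R"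
  shows "norm (regularized_cauchy_int R g z - regularized_cauchy_int R g z') \<le>
    2 * M * norm (z - z') powr \<alpha> * (2 * (2 * R) powr (1 - \<alpha>) / (1 - \<alpha>))"
proof -
  have M: "M \<ge> 0" and lip: "\<And>x y. \<bar>g x - g y\<bar> \<le> M * \<bar>x - y\<bar>"
    using g by (auto simp: lipschitz_on_def dist_real_def)
  have cont: "continuous_on {-R..R} g"
    using lipschitz_on_continuous_on[OF g] continuous_on_subset by blast
  define f where "f z \<xi> = complex_of_real (g \<xi> - g (Re z)) / (complex_of_real \<xi> - z)" for z \<xi>
  define \<delta> where "\<delta> = norm (z - z')"
  have f_bound: "norm (f z \<xi>) \<le> M" if "Im z \<noteq> 0" for z \<xi>
  proof -
    have "\<bar>g \<xi> - g (Re z)\<bar> \<le> M * norm (complex_of_real \<xi> - z)"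
      using lip[of \<xi> "Re z"] abs_Re_le_cmod[of "complex_of_real \<xi> - z"] M
      by (auto intro: order_trans mult_left_mono)
    then show ?thesis
      using of_real_diff_nonzero[OF that, of \<xi>] by (simp add: f_def norm_divide norm_of_real divide_le_eq del: of_real_diff)
  qed
  have "norm (f z \<xi> - f z' \<xi>) \<le> 2 * M * \<delta> powr \<alpha> * \<bar>\<xi> - Re z'\<bar> powr - \<alpha>" if \<xi>: "\<xi> \<noteq> Re z'" for \<xi>
  proof -
    define \<zeta> where "\<zeta> = complex_of_real \<xi> - z"
    define \<zeta>' where "\<zeta>' = complex_of_real \<xi> - z'"
    have nz: "\<zeta> \<noteq> 0" "\<zeta>' \<noteq> 0"
      using of_real_diff_nonzero z z' by (auto simp: \<zeta>_def \<zeta>'_def)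
    have diff: "\<zeta>' - \<zeta> = z - z'" by (simp add: \<zeta>_def \<zeta>'_def)
    \<comment> \<open>Since \<open>\<zeta> * f z \<xi> = g \<xi> - g (Re z)\<close>, and likewise
      for \<open>z'\<close>, the term \<open>g \<xi>\<close> cancels over the denominator
      \<open>\<zeta>'\<close>.\<close>
    have "f z \<xi> - f z' \<xi> = f z \<xi> * (z - z') / \<zeta>' + complex_of_real (g (Re z') - g (Re z)) / \<zeta>'"
      using nz unfolding diff[symmetric] f_def \<zeta>_def[symmetric] \<zeta>'_def[symmetric]
      by (simp add: field_simps)
    also have "norm \<dots> \<le> norm (f z \<xi>) * \<delta> / norm \<zeta>' + \<bar>g (Re z') - g (Re z)\<bar> / norm \<zeta>'"
      by (rule order_trans[OF norm_triangle_ineq]) (simp add: norm_mult norm_divide \<delta>_def del: of_real_diff)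
    also have "\<dots> \<le> M * \<delta> / norm \<zeta>' + M * \<delta> / norm \<zeta>'"
    proof (intro add_mono divide_right_mono mult_right_mono f_bound z)
      show "\<bar>g (Re z') - g (Re z)\<bar> \<le> M * \<delta>"
        using lip[of "Re z'" "Re z"] abs_Re_le_cmod[of "z - z'"] M
        by (auto simp: \<delta>_def abs_minus_commute intro: order_trans mult_left_mono)
    qed (auto simp: \<delta>_def)
    finally have 1: "norm (f z \<xi> - f z' \<xi>) \<le> 2 * M * (\<delta> / norm \<zeta>')" by simp
    have 2: "norm (f z \<xi> - f z' \<xi>) \<le> 2 * M * 1"
      using norm_triangle_ineq4[of "f z \<xi>" "f z' \<xi>"] f_bound[OF z, of \<xi>] f_bound[OF z'(1), of \<xi>] by simp
    define t where "t = \<delta> / norm \<zeta>'"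
    have t0: "t \<ge> 0" by (simp add: t_def \<delta>_def)
    \<comment> \<open>Interpolation between the two bounds: a singularity of exponent 1 at
      \<open>Re z'\<close>, which is not integrable, is exchanged for one of exponent
      \<open>\<alpha> < 1\<close>.\<close>
    have "min t 1 \<le> t powr \<alpha>"
    proof (cases "t \<le> 1")
      case True
      then show ?thesis using powr_mono'[of \<alpha> 1 t] t0 \<alpha> by simp
    next
      case False
      then show ?thesis using ge_one_powr_ge_zero[of t \<alpha>] \<alpha> by simp
    qed
    also have "\<dots> \<le> (\<delta> / \<bar>\<xi> - Re z'\<bar>) powr \<alpha>"
    proof (rule powr_mono2)
      show "t \<le> \<delta> / \<bar>\<xi> - Re z'\<bar>"
        unfolding t_def using abs_Re_le_cmod[of \<zeta>'] \<xi>
        by (intro divide_left_mono) (auto simp: \<zeta>'_def \<delta>_def intro!: mult_pos_pos)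
    qed (use \<alpha> t0 in auto)
    also have "\<dots> = \<delta> powr \<alpha> * \<bar>\<xi> - Re z'\<bar> powr - \<alpha>"
      by (simp add: powr_divide powr_minus_divide \<delta>_def)
    finally have *: "min t 1 \<le> \<delta> powr \<alpha> * \<bar>\<xi> - Re z'\<bar> powr - \<alpha>" .
    have "norm (f z \<xi> - f z' \<xi>) \<le> 2 * M * min t 1" using 1 2 by (auto simp: min_def t_def)
    also have "\<dots> \<le> 2 * M * (\<delta> powr \<alpha> * \<bar>\<xi> - Re z'\<bar> powr - \<alpha>)"
      using * M by (intro mult_left_mono) auto
    finally show ?thesis by (simp add: mult.assoc)
  qed
  moreover have int: "f z integrable_on {-R..R}" "f z' integrable_on {-R..R}"
    unfolding f_def by (rule regularized_cauchy_int_integrable[OF cont z] regularized_cauchy_int_integrable[OF cont z'(1)])+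
  ultimately have "norm (integral {-R..R} (\<lambda>\<xi>. f z \<xi> - f z' \<xi>)) \<le>
      2 * M * \<delta> powr \<alpha> * (2 * (2 * R) powr (1 - \<alpha>) / (1 - \<alpha>))"
    using M \<alpha> z' by (intro norm_integral_le_abs_powr[of \<alpha> "Re z'"] integrable_diff) auto
  also have "integral {-R..R} (\<lambda>\<xi>. f z \<xi> - f z' \<xi>) = regularized_cauchy_int R g z - regularized_cauchy_int R g z'"
    unfolding regularized_cauchy_int_def using Henstock_Kurzweil_Integration.integral_diff[OF int]
    by (simp only: f_def[abs_def])
  finally show ?thesis by (simp add: \<delta>_def)
qed

section \<open>The logarithmic part of the Cauchy integral\<close>

lemma integral_cauchy_kernel:
  assumes z: "Im z > 0" and R: "R \<ge> 0"
  shows "((\<lambda>\<xi>. 1 / (complex_of_real \<xi> - z)) has_integral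
    (Ln (of_real R - z) - Ln (of_real R + z) + \<i> * pi)) {-R..R}"
proof -
  have "((\<lambda>\<xi>. 1 / (complex_of_real \<xi> - z)) has_integral
      (Ln (of_real R - z) - Ln (of_real (-R) - z))) {-R..R}"
  proof (rule fundamental_theorem_of_calculus)
    fix \<xi> :: real
    \<comment> \<open>The imaginary part of \<open>\<xi> - z\<close> is negative, so the path of
      integration avoids the branch cut of \<open>Ln\<close>.\<close>
    have "complex_of_real \<xi> - z \<notin> \<real>\<^sub>\<le>\<^sub>0"
      using z by (auto simp: complex_nonpos_Reals_iff)
    then have "((\<lambda>w. Ln (w - z)) has_field_derivative 1 / (complex_of_real \<xi> - z)) (at (complex_of_real \<xi>))"
      by (auto intro!: derivative_eq_intros simp: divide_inverse)
    then show "((\<lambda>\<xi>. Ln (complex_of_real \<xi> - z)) has_vector_derivative 1 / (complex_of_real \<xi> - z)) (at \<xi> within {-R..R})"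
      by (rule has_vector_derivative_real_field[THEN has_vector_derivative_at_within])
  qed (use R in simp)
  also have "complex_of_real (-R) - z = - (of_real R + z)" by simp
  \<comment> \<open>Passing from \<open>- (R + z)\<close> to \<open>R + z\<close> produces the
    summand \<open>\<i> * pi\<close>, the source of the imaginary boundary value; the remaining two
    logarithms become real when \<open>z\<close> tends to a point of \<open>(-R, R)\<close>.\<close>
  also have "Ln (- (of_real R + z)) = Ln (of_real R + z) - \<i> * pi"
    using z by (subst Ln_minus) (auto simp: complex_eq_iff)
  finally show ?thesis by (simp only: diff_diff_eq2 diff_add_eq)
qed

lemma cauchy_int_decomposition:
  assumes "continuous_on {-R..R} g" "\<And>x. \<bar>x\<bar> > R \<Longrightarrow> g x = 0" "R \<ge> 0" "Im z > 0"
  shows "cauchy_int g z = regularized_cauchy_int R g z +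
    of_real (g (Re z)) * (Ln (of_real R - z) - Ln (of_real R + z) + \<i> * pi)"
proof -
  let ?L = "Ln (of_real R - z) - Ln (of_real R + z) + \<i> * pi"
  have z: "Im z \<noteq> 0" using assms by simp
  have 1: "((\<lambda>\<xi>. of_real (g (Re z)) * (1 / (complex_of_real \<xi> - z))) has_integral (of_real (g (Re z)) * ?L)) {-R..R}"
    by (intro has_integral_mult_right integral_cauchy_kernel assms)
  have 2: "((\<lambda>\<xi>. complex_of_real (g \<xi> - g (Re z)) / (complex_of_real \<xi> - z)) has_integral regularized_cauchy_int R g z) {-R..R}"
    unfolding regularized_cauchy_int_def by (intro integrable_integral regularized_cauchy_int_integrable assms z)
  have "cauchy_int g z = integral {-R..R} (\<lambda>\<xi>. complex_of_real (g \<xi>) / (complex_of_real \<xi> - z))"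
    by (rule cauchy_int_eq[OF assms(1,2) z])
  also have "\<dots> = integral {-R..R} (\<lambda>\<xi>. complex_of_real (g \<xi> - g (Re z)) / (complex_of_real \<xi> - z) +
       of_real (g (Re z)) * (1 / (complex_of_real \<xi> - z)))"
    by (intro integral_cong) (simp add: diff_divide_distrib)
  also have "\<dots> = regularized_cauchy_int R g z + of_real (g (Re z)) * ?L"
    by (rule integral_unique[OF has_integral_add[OF 2 1]])
  finally show ?thesis .
qed

text \<open>Mean value inequality on a convex half plane where the derivative of \<open>Ln\<close>
  has norm at most 1.\<close>

lemma Ln_lipschitz:
  assumes "Re u \<ge> 1" "Re v \<ge> 1"
  shows "norm (Ln u - Ln v) \<le> norm (u - v)"
proof -
  have "norm (Ln u - Ln v) \<le> 1 * norm (u - v)"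
  proof (rule field_differentiable_bound[where S = "{z. Re z \<ge> 1}" and f' = inverse])
    show "convex {z. Re z \<ge> 1}" by (rule convex_halfspace_Re_ge)
    fix z assume z: "z \<in> {z. Re z \<ge> 1}"
    then have "z \<notin> \<real>\<^sub>\<le>\<^sub>0" by (auto simp: complex_nonpos_Reals_iff)
    then show "(Ln has_field_derivative inverse z) (at z within {z. Re z \<ge> 1})"
      by (rule has_field_derivative_Ln[THEN has_field_derivative_at_within])
    have "1 \<le> norm z" using z complex_Re_le_cmod[of z] by simp
    then show "norm (inverse z) \<le> 1" by (simp add: norm_inverse inverse_le_1_iff)
  qed (use assms in auto)
  then show ?thesis by simp
qed

text \<open>Both parts of the decomposition are estimated for \<open>norm z \<le> r\<close>. The
  regularized integral is already Hoelder; the product of \<open>g (Re z)\<close> with the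
  logarithmic factor is Lipschitz there, hence Hoelder because distances are at most
  \<open>2 * r\<close>.\<close>

lemma cauchy_int_holder:
  assumes g: "M-lipschitz_on UNIV g" and supp: "\<And>x. \<bar>x\<bar> > R0 \<Longrightarrow> g x = 0" and \<alpha>: "0 < \<alpha>" "\<alpha> < 1"
  shows "\<exists>C\<ge>0. \<forall>z z'. Im z > 0 \<longrightarrow> Im z' > 0 \<longrightarrow> norm z \<le> r \<longrightarrow> norm z' \<le> r \<longrightarrow>
    norm (cauchy_int g z - cauchy_int g z') \<le> C * norm (z - z') powr \<alpha>"
proof -
  \<comment> \<open>With this \<open>R\<close> the density vanishes outside \<open>{-R..R}\<close>,
    and \<open>of_real R - z\<close> and \<open>of_real R + z\<close> have real part at least 1 for
    \<open>norm z \<le> r\<close>, as \<open>Ln_lipschitz\<close> requires.\<close>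
  define R where "R = \<bar>R0\<bar> + \<bar>r\<bar> + 1"
  have M: "M \<ge> 0" and lip: "\<And>x y. \<bar>g x - g y\<bar> \<le> M * \<bar>x - y\<bar>"
    using g by (auto simp: lipschitz_on_def dist_real_def)
  have cont: "continuous_on {-R..R} g"
    using lipschitz_on_continuous_on[OF g] continuous_on_subset by blast
  have R: "R \<ge> 1" and Rr: "r + 1 \<le> R" and supp': "\<And>x. \<bar>x\<bar> > R \<Longrightarrow> g x = 0"
    using supp by (auto simp: R_def)
  define \<Lambda> where "\<Lambda> z = Ln (of_real R - z) - Ln (of_real R + z) + \<i> * pi" for z
  have \<Lambda>_lip: "norm (\<Lambda> z - \<Lambda> z') \<le> 2 * norm (z - z')" if "norm z \<le> r" "norm z' \<le> r" for z z'
  proof -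
    have "norm (\<Lambda> z - \<Lambda> z') = norm ((Ln (of_real R - z) - Ln (of_real R - z')) - (Ln (of_real R + z) - Ln (of_real R + z')))"
      by (simp add: \<Lambda>_def algebra_simps)
    also have "\<dots> \<le> norm (Ln (of_real R - z) - Ln (of_real R - z')) + norm (Ln (of_real R + z) - Ln (of_real R + z'))"
      by (rule norm_triangle_ineq4)
    also have "\<dots> \<le> norm ((of_real R - z) - (of_real R - z')) + norm ((of_real R + z) - (of_real R + z'))"
      using that Rr abs_Re_le_cmod[of z] abs_Re_le_cmod[of z'] by (intro add_mono Ln_lipschitz) auto
    finally show ?thesis by (simp add: norm_minus_commute)
  qed
  \<comment> \<open>\<open>\<Lambda> 0 = \<i> * pi\<close>, and \<open>\<Lambda>\<close> is
    2-Lipschitz on the disc of radius \<open>r\<close>.\<close>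
  define B where "B = 2 * r + pi"
  have \<Lambda>_bound: "norm (\<Lambda> z) \<le> B" if "norm z \<le> r" for z
  proof -
    have "\<Lambda> 0 = \<i> * pi" by (simp add: \<Lambda>_def)
    moreover have "0 \<le> r" using that norm_ge_zero order_trans by blast
    ultimately show ?thesis
      using \<Lambda>_lip[OF that, of 0] norm_triangle_ineq2[of "\<Lambda> z" "\<Lambda> 0"] that by (simp add: B_def norm_mult)
  qed
  define G where "G = M * (2 * R + 1)"
  have g_bound: "\<bar>g x\<bar> \<le> G" if "\<bar>x\<bar> \<le> r" for x
  proof -
    have "\<bar>g x\<bar> = \<bar>g x - g (R + 1)\<bar>" using supp'[of "R + 1"] R by simp
    also have "\<dots> \<le> M * \<bar>x - (R + 1)\<bar>" by (rule lip)
    also have "\<dots> \<le> G" unfolding G_def using that Rr M by (intro mult_left_mono) auto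
    finally show ?thesis .
  qed
  define C where "C = 2 * M * (2 * (2 * R) powr (1 - \<alpha>) / (1 - \<alpha>)) + (M * \<bar>B\<bar> + 2 * G) * (2 * \<bar>r\<bar>) powr (1 - \<alpha>)"
  have "C \<ge> 0" unfolding C_def G_def using M R \<alpha> by (intro add_nonneg_nonneg mult_nonneg_nonneg divide_nonneg_nonneg) auto
  moreover have "norm (cauchy_int g z - cauchy_int g z') \<le> C * norm (z - z') powr \<alpha>"
    if z: "Im z > 0" "Im z' > 0" "norm z \<le> r" "norm z' \<le> r" for z z'
  proof -
    let ?\<delta> = "norm (z - z')"
    have r: "r \<ge> 0" using z(3) norm_ge_zero order_trans by blast
    have "?\<delta> = ?\<delta> powr (1 - \<alpha>) * ?\<delta> powr \<alpha>" by (simp add: powr_add[symmetric])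
    also have "\<dots> \<le> (2 * \<bar>r\<bar>) powr (1 - \<alpha>) * ?\<delta> powr \<alpha>"
      using \<alpha> z norm_triangle_ineq4[of z z'] by (intro mult_right_mono powr_mono2) auto
    finally have \<delta>: "?\<delta> \<le> (2 * \<bar>r\<bar>) powr (1 - \<alpha>) * ?\<delta> powr \<alpha>" .
    have T: "norm (regularized_cauchy_int R g z - regularized_cauchy_int R g z') \<le>
        2 * M * ?\<delta> powr \<alpha> * (2 * (2 * R) powr (1 - \<alpha>) / (1 - \<alpha>))"
      using z Rr abs_Re_le_cmod[of z'] by (intro regularized_cauchy_int_holder g \<alpha>) auto
    have "norm (of_real (g (Re z)) * \<Lambda> z - of_real (g (Re z')) * \<Lambda> z') =
        norm (of_real (g (Re z) - g (Re z')) * \<Lambda> z + of_real (g (Re z')) * (\<Lambda> z - \<Lambda> z'))"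
      by (simp add: algebra_simps)
    also have "\<dots> \<le> \<bar>g (Re z) - g (Re z')\<bar> * norm (\<Lambda> z) + \<bar>g (Re z')\<bar> * norm (\<Lambda> z - \<Lambda> z')"
      by (rule order_trans[OF norm_triangle_ineq]) (simp add: norm_mult del: of_real_diff)
    also have "\<dots> \<le> (M * ?\<delta>) * \<bar>B\<bar> + G * (2 * ?\<delta>)"
    proof (intro add_mono mult_mono)
      show "\<bar>g (Re z) - g (Re z')\<bar> \<le> M * ?\<delta>"
        using lip[of "Re z" "Re z'"] abs_Re_le_cmod[of "z - z'"] M by (auto intro: order_trans mult_left_mono)
      show "\<bar>g (Re z')\<bar> \<le> G" using abs_Re_le_cmod[of z'] z by (intro g_bound) auto
    qed (use z \<Lambda>_bound[of z] \<Lambda>_lip[of z z'] M R in \<open>auto simp: G_def\<close>)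
    also have "\<dots> = (M * \<bar>B\<bar> + 2 * G) * ?\<delta>" by (simp add: algebra_simps)
    also have "\<dots> \<le> (M * \<bar>B\<bar> + 2 * G) * ((2 * \<bar>r\<bar>) powr (1 - \<alpha>) * ?\<delta> powr \<alpha>)"
      using \<delta> M R by (intro mult_left_mono) (auto simp: G_def)
    finally have L: "norm (of_real (g (Re z)) * \<Lambda> z - of_real (g (Re z')) * \<Lambda> z') \<le> \<dots>" .
    have "cauchy_int g z - cauchy_int g z' = (regularized_cauchy_int R g z - regularized_cauchy_int R g z') +
       (of_real (g (Re z)) * \<Lambda> z - of_real (g (Re z')) * \<Lambda> z')"
      using cauchy_int_decomposition[OF cont supp'] z R by (simp add: \<Lambda>_def)
    then have "norm (cauchy_int g z - cauchy_int g z') \<le> norm (regularized_cauchy_int R g z - regularized_cauchy_int R g z') +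
       norm (of_real (g (Re z)) * \<Lambda> z - of_real (g (Re z')) * \<Lambda> z')"
      by (metis norm_triangle_ineq)
    also have "\<dots> \<le> C * ?\<delta> powr \<alpha>" using add_mono[OF T L] by (simp add: C_def algebra_simps)
    finally show ?thesis .
  qed
  ultimately show ?thesis by blast
qed

section \<open>Boundary values\<close>

text \<open>The constant depends on the radius only and not on the distance to the real axis; this
  uniformity is what yields boundary values.\<close>

definition half_plane_holder :: "real \<Rightarrow> (complex \<Rightarrow> complex) \<Rightarrow> bool" where
  "half_plane_holder \<alpha> Q \<longleftrightarrow> (\<forall>r. \<exists>C\<ge>0. \<forall>z z'. Im z > 0 \<longrightarrow> Im z' > 0 \<longrightarrow> norm z \<le> r \<longrightarrow> norm z' \<le> r \<longrightarrow>
    norm (Q z - Q z') \<le> C * norm (z - z') powr \<alpha>)"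

text \<open>The limit is taken vertically from above at every \<open>z\<close>, not only at real
  points, so that one formula describes the extension on the whole closed half plane.\<close>

definition boundary_value :: "(complex \<Rightarrow> complex) \<Rightarrow> complex \<Rightarrow> complex" where
  "boundary_value Q z = lim (\<lambda>n. Q (z + \<i> * of_real (inverse (real (Suc n)))))"

lemma norm_shift_le: "norm (z + \<i> * of_real (inverse (real (Suc n)))) \<le> norm z + 1"
proof -
  have "norm (\<i> * complex_of_real (inverse (real (Suc n)))) \<le> 1"
    by (simp only: norm_mult norm_ii norm_of_real) (simp add: field_simps)
  then show ?thesis using norm_triangle_ineq[of z "\<i> * of_real (inverse (real (Suc n)))"] by simp
qed

lemma Im_shift_pos: "Im z \<ge> 0 \<Longrightarrow> Im (z + \<i> * of_real (inverse (real (Suc n)))) > 0"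
  by (simp add: add_nonneg_pos)

lemma shift_tendsto: "(\<lambda>n. z + \<i> * of_real (inverse (real (Suc n)))) \<longlonglongrightarrow> z"
proof -
  have "(\<lambda>n. z + \<i> * complex_of_real (inverse (real (Suc n)))) \<longlonglongrightarrow> z + \<i> * of_real 0"
    by (intro tendsto_intros LIMSEQ_inverse_real_of_nat)
  then show ?thesis by simp
qed

text \<open>The Hoelder estimate makes \<open>Q\<close> uniformly continuous on a bounded piece of
  the half plane that contains all shifted points, so it maps their Cauchy sequence to a Cauchy
  sequence.\<close>

lemma boundary_value_tendsto:
  assumes Q: "half_plane_holder \<alpha> Q" and \<alpha>: "\<alpha> > 0" and z: "Im z \<ge> 0"
  shows "(\<lambda>n. Q (z + \<i> * of_real (inverse (real (Suc n))))) \<longlonglongrightarrow> boundary_value Q z"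
proof -
  define S where "S = {u. Im u > 0 \<and> norm u \<le> norm z + 1}"
  obtain C where C: "C \<ge> 0" "\<And>u v. u \<in> S \<Longrightarrow> v \<in> S \<Longrightarrow> norm (Q u - Q v) \<le> C * norm (u - v) powr \<alpha>"
    using Q unfolding half_plane_holder_def S_def by blast
  have "uniformly_continuous_on S Q"
    unfolding uniformly_continuous_on_def
  proof (intro allI impI)
    fix e :: real assume e: "e > 0"
    \<comment> \<open>Solves \<open>(C + 1) * d powr \<alpha> = e\<close>; the added 1 covers
      \<open>C = 0\<close>.\<close>
    define d where "d = (e / (C + 1)) powr (1 / \<alpha>)"
    have "d > 0" using e C by (simp add: d_def)
    moreover have "dist (Q v) (Q u) < e" if "u \<in> S" "v \<in> S" "dist v u < d" for u v
    proof -
      have "norm (v - u) powr \<alpha> \<le> d powr \<alpha>"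
        using that \<alpha> by (intro powr_mono2) (auto simp: dist_norm)
      also have "\<dots> = e / (C + 1)" using \<alpha> e C by (simp add: d_def powr_powr)
      finally have "norm (v - u) powr \<alpha> \<le> e / (C + 1)" .
      then have "C * norm (v - u) powr \<alpha> \<le> C * (e / (C + 1))" using C(1) by (rule mult_left_mono)
      also have "\<dots> < e" using C(1) e by (simp add: field_simps)
      finally show ?thesis using C(2)[OF that(2,1)] by (simp add: dist_norm)
    qed
    ultimately show "\<exists>d>0. \<forall>u\<in>S. \<forall>v\<in>S. dist v u < d \<longrightarrow> dist (Q v) (Q u) < e" by blast
  qed
  moreover have "z + \<i> * of_real (inverse (real (Suc n))) \<in> S" for n
    unfolding S_def using norm_shift_le Im_shift_pos[OF z] by blast
  ultimately have "Cauchy (\<lambda>n. Q (z + \<i> * of_real (inverse (real (Suc n)))))"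
    using uniformly_continuous_on_Cauchy[OF _ LIMSEQ_imp_Cauchy[OF shift_tendsto]] by blast
  then show ?thesis
    unfolding boundary_value_def by (simp add: Cauchy_convergent_iff convergent_LIMSEQ_iff)
qed

text \<open>Shifting both points by the same amount keeps their distance, so the estimate passes to
  the limit. The constant is that of radius \<open>r + 1\<close>, because a shift has length at most
  1.\<close>

lemma boundary_value_holder:
  assumes Q: "half_plane_holder \<alpha> Q" and \<alpha>: "\<alpha> > 0"
  shows "\<exists>C\<ge>0. \<forall>z z'. Im z \<ge> 0 \<longrightarrow> Im z' \<ge> 0 \<longrightarrow> norm z \<le> r \<longrightarrow> norm z' \<le> r \<longrightarrow>
    norm (boundary_value Q z - boundary_value Q z') \<le> C * norm (z - z') powr \<alpha>"
proof -
  obtain C where C: "C \<ge> 0" "\<And>z z'. Im z > 0 \<Longrightarrow> Im z' > 0 \<Longrightarrow> norm z \<le> r + 1 \<Longrightarrow> norm z' \<le> r + 1 \<Longrightarrow>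
    norm (Q z - Q z') \<le> C * norm (z - z') powr \<alpha>"
    using Q unfolding half_plane_holder_def by blast
  have "norm (boundary_value Q z - boundary_value Q z') \<le> C * norm (z - z') powr \<alpha>"
    if z: "Im z \<ge> 0" "Im z' \<ge> 0" "norm z \<le> r" "norm z' \<le> r" for z z'
  proof (rule LIMSEQ_le_const2)
    show "(\<lambda>n. norm (Q (z + \<i> * of_real (inverse (real (Suc n)))) - Q (z' + \<i> * of_real (inverse (real (Suc n))))))
        \<longlonglongrightarrow> norm (boundary_value Q z - boundary_value Q z')"
      using z by (intro tendsto_intros boundary_value_tendsto[OF Q \<alpha>])
    have "norm (Q (z + \<i> * of_real (inverse (real (Suc n)))) - Q (z' + \<i> * of_real (inverse (real (Suc n)))))
        \<le> C * norm (z - z') powr \<alpha>" for n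
      using C(2)[OF Im_shift_pos[of z n] Im_shift_pos[of z' n]] norm_shift_le[of z n] norm_shift_le[of z' n] z
      by (auto intro: order_trans)
    then show "\<exists>N. \<forall>n\<ge>N. norm (Q (z + \<i> * of_real (inverse (real (Suc n)))) - Q (z' + \<i> * of_real (inverse (real (Suc n)))))
        \<le> C * norm (z - z') powr \<alpha>"
      by blast
  qed
  with C(1) show ?thesis by blast
qed

text \<open>At an interior point \<open>z\<close> itself can be compared with its shifts, and the
  Hoelder bound tends to \<open>0\<close>.\<close>

lemma boundary_value_eq:
  assumes Q: "half_plane_holder \<alpha> Q" and \<alpha>: "\<alpha> > 0" and z: "Im z > 0"
  shows "boundary_value Q z = Q z"
proof -
  obtain C where C: "C \<ge> 0" "\<And>u v. Im u > 0 \<Longrightarrow> Im v > 0 \<Longrightarrow> norm u \<le> norm z + 1 \<Longrightarrow> norm v \<le> norm z + 1 \<Longrightarrow>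
    norm (Q u - Q v) \<le> C * norm (u - v) powr \<alpha>"
    using Q unfolding half_plane_holder_def by blast
  have "norm (boundary_value Q z - Q z) \<le> C * norm (z - z) powr \<alpha>"
  proof (rule LIMSEQ_le)
    show "(\<lambda>n. norm (Q (z + \<i> * of_real (inverse (real (Suc n)))) - Q z))
        \<longlonglongrightarrow> norm (boundary_value Q z - Q z)"
      using z by (intro tendsto_intros boundary_value_tendsto[OF Q \<alpha>]) auto
    show "(\<lambda>n. C * norm (z + \<i> * of_real (inverse (real (Suc n))) - z) powr \<alpha>) \<longlonglongrightarrow> C * norm (z - z) powr \<alpha>"
      using \<alpha> by (intro tendsto_intros shift_tendsto tendsto_powr') auto
    have "norm (Q (z + \<i> * of_real (inverse (real (Suc n)))) - Q z) \<le>
        C * norm (z + \<i> * of_real (inverse (real (Suc n))) - z) powr \<alpha>" for n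
      using z norm_shift_le[of z n] Im_shift_pos[of z n] by (intro C(2)) auto
    then show "\<exists>N. \<forall>n\<ge>N. norm (Q (z + \<i> * of_real (inverse (real (Suc n)))) - Q z) \<le>
        C * norm (z + \<i> * of_real (inverse (real (Suc n))) - z) powr \<alpha>" by blast
  qed
  then show ?thesis using \<alpha> by simp
qed

lemma boundary_value_loc_holder:
  assumes "half_plane_holder \<alpha> Q" "\<alpha> > 0" "S \<subseteq> {z. Im z \<ge> 0}"
  shows "loc_holder_on \<alpha> S (boundary_value Q)"
  unfolding loc_holder_on_def
proof (intro allI impI)
  fix K assume K: "compact K \<and> K \<subseteq> S"
  then obtain r where "\<And>z. z \<in> K \<Longrightarrow> norm z \<le> r"
    using compact_imp_bounded bounded_iff by metis
  then show "holder_on \<alpha> K (boundary_value Q)"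
    unfolding holder_on_def dist_norm using boundary_value_holder[OF assms(1,2), of r] K assms(3) by blast
qed

lemma cauchy_int_half_plane_holder:
  assumes "M-lipschitz_on UNIV g" "\<And>x. \<bar>x\<bar> > R \<Longrightarrow> g x = 0" "0 < \<alpha>" "\<alpha> < 1"
  shows "half_plane_holder \<alpha> (cauchy_int g)"
  unfolding half_plane_holder_def using cauchy_int_holder[OF assms] by blast

section \<open>Imaginary part of the boundary values\<close>

lemma regularized_cauchy_int_cnj: "regularized_cauchy_int R g (cnj z) = cnj (regularized_cauchy_int R g z)"
  unfolding regularized_cauchy_int_def Henstock_Kurzweil_Integration.integral_cnj
  by simp

text \<open>A form of the Sokhotski-Plemelj formula. By conjugation symmetry the imaginary part of
  the regularized integral is half its jump between \<open>z\<close> and \<open>cnj z\<close>, which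
  the Hoelder estimate sends to \<open>0\<close>; in the logarithmic part only
  \<open>\<i> * pi\<close> keeps an imaginary part.\<close>

lemma Im_boundary_value_cauchy_int:
  assumes g: "M-lipschitz_on UNIV g" and supp: "\<And>x. \<bar>x\<bar> > R0 \<Longrightarrow> g x = 0"
  shows "Im (boundary_value (cauchy_int g) (of_real x)) = pi * g x"
proof -
  define R where "R = \<bar>R0\<bar> + \<bar>x\<bar> + 1"
  define u where "u n = of_real x + \<i> * complex_of_real (inverse (real (Suc n)))" for n
  \<comment> \<open>Any exponent strictly between 0 and 1 serves.\<close>
  define \<alpha> :: real where "\<alpha> = 1/2"
  define K where "K = 2 * M * (2 * (2 * R) powr (1 - \<alpha>) / (1 - \<alpha>))"
  have cont: "continuous_on {-R..R} g"
    using lipschitz_on_continuous_on[OF g] continuous_on_subset by blast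
  have u_lim: "u \<longlonglongrightarrow> of_real x" unfolding u_def by (rule shift_tendsto)
  have Re_u: "Re (u n) = x" and Im_u: "Im (u n) > 0" for n by (simp_all add: u_def)
  have T: "(\<lambda>n. Im (regularized_cauchy_int R g (u n))) \<longlonglongrightarrow> 0"
  proof (rule Lim_null_comparison)
    have "norm (Im (regularized_cauchy_int R g (u n))) \<le> K * norm (u n - cnj (u n)) powr \<alpha>" for n
    proof -
      have "regularized_cauchy_int R g (u n) - regularized_cauchy_int R g (cnj (u n)) =
          of_real (2 * Im (regularized_cauchy_int R g (u n))) * \<i>"
        unfolding regularized_cauchy_int_cnj by (rule complex_diff_cnj)
      then have "2 * \<bar>Im (regularized_cauchy_int R g (u n))\<bar> = norm (regularized_cauchy_int R g (u n) - regularized_cauchy_int R g (cnj (u n)))"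
        by (simp add: norm_mult)
      also have "\<dots> \<le> 2 * M * norm (u n - cnj (u n)) powr \<alpha> * (2 * (2 * R) powr (1 - \<alpha>) / (1 - \<alpha>))"
        using Im_u[of n] by (intro regularized_cauchy_int_holder g) (auto simp: \<alpha>_def Re_u R_def)
      finally show ?thesis by (simp add: K_def algebra_simps)
    qed
    then show "\<forall>\<^sub>F n in sequentially. norm (Im (regularized_cauchy_int R g (u n))) \<le> K * norm (u n - cnj (u n)) powr \<alpha>"
      by simp
    have "(\<lambda>n. K * norm (u n - cnj (u n)) powr \<alpha>) \<longlonglongrightarrow> K * norm (complex_of_real x - cnj (of_real x)) powr \<alpha>"
      by (intro tendsto_intros u_lim tendsto_powr') (auto simp: \<alpha>_def)
    then show "(\<lambda>n. K * norm (u n - cnj (u n)) powr \<alpha>) \<longlonglongrightarrow> 0" by (simp add: \<alpha>_def)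
  qed
  have L: "(\<lambda>n. Im (of_real (g (Re (u n))) * (Ln (of_real R - u n) - Ln (of_real R + u n) + \<i> * pi)))
     \<longlonglongrightarrow> Im (of_real (g x) * (Ln (of_real R - of_real x) - Ln (of_real R + of_real x) + \<i> * pi))"
    unfolding Re_u by (intro tendsto_intros u_lim) (auto simp: complex_nonpos_Reals_iff R_def)
  have "Im (of_real (g x) * (Ln (of_real R - of_real x) - Ln (of_real R + of_real x) + \<i> * pi)) = pi * g x"
  proof -
    have "Im (Ln (complex_of_real (R - x))) = 0" "Im (Ln (complex_of_real (R + x))) = 0"
      by (subst Ln_of_real; simp add: R_def)+
    then show ?thesis by (simp add: algebra_simps)
  qed
  moreover have "cauchy_int g (u n) = regularized_cauchy_int R g (u n) +
      of_real (g (Re (u n))) * (Ln (of_real R - u n) - Ln (of_real R + u n) + \<i> * pi)" for n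
    using supp Im_u by (intro cauchy_int_decomposition cont) (auto simp: R_def)
  ultimately have "(\<lambda>n. Im (cauchy_int g (u n))) \<longlonglongrightarrow> pi * g x"
    using tendsto_add[OF T L] by (simp only: plus_complex.sel add_0)
  moreover have "(\<lambda>n. Im (cauchy_int g (u n))) \<longlonglongrightarrow> Im (boundary_value (cauchy_int g) (of_real x))"
    unfolding u_def
    by (intro tendsto_intros boundary_value_tendsto[of "1/2"] cauchy_int_half_plane_holder[OF g supp]) auto
  ultimately show ?thesis by (rule LIMSEQ_unique[symmetric])
qed

lemma boundary_value_cauchy_int_lincomb:
  assumes g: "M-lipschitz_on UNIV g" "\<And>x. \<bar>x\<bar> > R \<Longrightarrow> g x = 0"
    and g': "M'-lipschitz_on UNIV g'" "\<And>x. \<bar>x\<bar> > R' \<Longrightarrow> g' x = 0"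
    and z: "Im z \<ge> 0"
  shows "boundary_value (cauchy_int (\<lambda>x. c * g x + c' * g' x)) z =
    of_real c * boundary_value (cauchy_int g) z + of_real c' * boundary_value (cauchy_int g') z"
proof -
  have cont: "continuous_on A g" "continuous_on A g'" for A
    using lipschitz_on_continuous_on[OF g(1)] lipschitz_on_continuous_on[OF g'(1)] continuous_on_subset by blast+
  have "(\<lambda>n. cauchy_int (\<lambda>x. c * g x + c' * g' x) (z + \<i> * of_real (inverse (real (Suc n))))) \<longlonglongrightarrow>
    of_real c * boundary_value (cauchy_int g) z + of_real c' * boundary_value (cauchy_int g') z"
  proof (subst cauchy_int_lincomb[of "max R R'"])
    show "(\<lambda>n. of_real c * cauchy_int g (z + \<i> * of_real (inverse (real (Suc n)))) +
        of_real c' * cauchy_int g' (z + \<i> * of_real (inverse (real (Suc n))))) \<longlonglongrightarrow>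
      of_real c * boundary_value (cauchy_int g) z + of_real c' * boundary_value (cauchy_int g') z"
      by (intro tendsto_intros boundary_value_tendsto[of "1/2"] z cauchy_int_half_plane_holder[OF g]
          cauchy_int_half_plane_holder[OF g']) auto
  qed (use g g' cont Im_shift_pos[OF z] in \<open>auto simp: less_imp_neq[THEN not_sym]\<close>)
  then show ?thesis unfolding boundary_value_def by (rule limI)
qed

section \<open>Uniform splines and moment expansions\<close>

text \<open>The mesh \<open>h\<close> is fixed and the grid starts at \<open>0\<close>, which makes
  this a vector space; a sum of expansions with different meshes need not be a uniform
  expansion.\<close>

definition uniform_splines :: "nat \<Rightarrow> real \<Rightarrow> (real \<Rightarrow> real) set" where
  "uniform_splines m h = {g. \<exists>(K :: int set) c. finite K \<and>
     g = (\<lambda>x. \<Sum>k\<in>K. c k * cardinal_bspline m (x / h - of_int k))}"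

lemma uniform_splinesI:
  "finite K \<Longrightarrow> (\<lambda>x. \<Sum>k\<in>K. c k * cardinal_bspline m (x / h - of_int k)) \<in> uniform_splines m h"
  unfolding uniform_splines_def by blast

lemma uniform_splines_expansion:
  assumes "g \<in> uniform_splines m h" "h > 0"
  shows "uniform_bspline_expansion m g"
proof -
  obtain K c where "finite K" "g = (\<lambda>x. \<Sum>k\<in>K. c k * cardinal_bspline m (x / h - of_int k))"
    using assms(1) by (auto simp: uniform_splines_def)
  then show ?thesis
    unfolding uniform_bspline_expansion_def using assms(2)
    by (intro exI[of _ h] exI[of _ 0] exI[of _ K] exI[of _ c]) simp
qed

lemma uniform_splines_lincomb:
  assumes "g \<in> uniform_splines m h" "g' \<in> uniform_splines m h"
  shows "(\<lambda>x. a * g x + a' * g' x) \<in> uniform_splines m h"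
proof -
  obtain K c where K: "finite K" "g = (\<lambda>x. \<Sum>k\<in>K. c k * cardinal_bspline m (x / h - of_int k))"
    using assms(1) by (auto simp: uniform_splines_def)
  obtain K' c' where K': "finite K'" "g' = (\<lambda>x. \<Sum>k\<in>K'. c' k * cardinal_bspline m (x / h - of_int k))"
    using assms(2) by (auto simp: uniform_splines_def)
  define d where "d k = a * (if k \<in> K then c k else 0) + a' * (if k \<in> K' then c' k else 0)" for k
  have "(\<lambda>x. a * g x + a' * g' x) = (\<lambda>x. \<Sum>k\<in>K \<union> K'. d k * cardinal_bspline m (x / h - of_int k))"
  proof
    fix x
    have 1: "g x = (\<Sum>k\<in>K \<union> K'. (if k \<in> K then c k else 0) * cardinal_bspline m (x / h - of_int k))"
      unfolding K(2) using K(1) K'(1) by (intro sum.mono_neutral_cong_left) auto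
    have 2: "g' x = (\<Sum>k\<in>K \<union> K'. (if k \<in> K' then c' k else 0) * cardinal_bspline m (x / h - of_int k))"
      unfolding K'(2) using K(1) K'(1) by (intro sum.mono_neutral_cong_left) auto
    show "a * g x + a' * g' x = (\<Sum>k\<in>K \<union> K'. d k * cardinal_bspline m (x / h - of_int k))"
      unfolding 1 2 sum_distrib_left sum.distrib[symmetric] d_def
      by (intro sum.cong) (simp_all add: algebra_simps)
  qed
  then show ?thesis using uniform_splinesI[of "K \<union> K'" d m h] K(1) K'(1) by simp
qed

lemma uniform_splines_lipschitz:
  assumes "g \<in> uniform_splines m h" "m \<ge> 2"
  shows "\<exists>L. L-lipschitz_on UNIV g"
proof -
  obtain K c where K: "finite K" "g = (\<lambda>x. \<Sum>k\<in>K. c k * cardinal_bspline m (x / h - of_int k))"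
    using assms(1) by (auto simp: uniform_splines_def)
  obtain L where L: "L-lipschitz_on UNIV (cardinal_bspline m)"
    using cardinal_bspline_lipschitz[OF assms(2)] ..
  have "\<exists>L. L-lipschitz_on UNIV (\<lambda>x. \<Sum>k\<in>K. c k * cardinal_bspline m (x / h - of_int k))"
    using K(1)
  proof (induction K)
    case empty
    have "0-lipschitz_on UNIV (\<lambda>x. \<Sum>k\<in>{}. c k * cardinal_bspline m (x / h - of_int k))"
      by (simp add: lipschitz_on_def)
    then show ?case ..
  next
    case (insert k K)
    obtain L' where L': "L'-lipschitz_on UNIV (\<lambda>x. \<Sum>k\<in>K. c k * cardinal_bspline m (x / h - of_int k))"
      using insert.IH ..
    have "\<exists>L. L-lipschitz_on UNIV (\<lambda>x. c k *\<^sub>R cardinal_bspline m ((1 / h) * x + - of_int k)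
        + (\<Sum>k\<in>K. c k * cardinal_bspline m (x / h - of_int k)))"
      using lipschitz_on_add[OF lipschitz_on_cmult[OF lipschitz_on_affine[OF L]] L'] by blast
    then show ?case using insert.hyps by simp
  qed
  then show ?thesis using K(2) by simp
qed

lemma uniform_splines_support:
  assumes "g \<in> uniform_splines m h" "m \<ge> 1" "h > 0"
  shows "\<exists>R. \<forall>x. \<bar>x\<bar> > R \<longrightarrow> g x = 0"
proof -
  obtain K c where K: "finite K" "g = (\<lambda>x. \<Sum>k\<in>K. c k * cardinal_bspline m (x / h - of_int k))"
    using assms(1) by (auto simp: uniform_splines_def)
  have "finite ((\<lambda>k. \<bar>real_of_int k\<bar>) ` K)" using K(1) by simp
  then obtain N where N: "\<And>k. k \<in> K \<Longrightarrow> \<bar>real_of_int k\<bar> \<le> N"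
    by (meson Max_ge finite_imageI imageI)
  have "g x = 0" if x: "\<bar>x\<bar> > h * (N + real m)" for x
    unfolding K(2)
  proof (intro sum.neutral ballI)
    fix k assume k: "k \<in> K"
    have "\<bar>x / h\<bar> > N + real m" using x \<open>h > 0\<close> by (simp add: field_simps)
    then have "x / h - of_int k < 0 \<or> real m \<le> x / h - of_int k" using N[OF k] by linarith
    then show "c k * cardinal_bspline m (x / h - of_int k) = 0"
      using cardinal_bspline_eq_0[OF \<open>m \<ge> 1\<close>] by simp
  qed
  then show ?thesis by blast
qed

text \<open>The coefficients are the samples \<open>f (h * k)\<close>. By the partition of unity the
  error at \<open>x\<close> is a convex combination of the differences
  \<open>f (h * k) - f x\<close>, and only samples within \<open>h * m\<close> of \<open>x\<close>
  contribute.\<close>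

lemma uniform_splines_approx:
  fixes f :: "real \<Rightarrow> real"
  assumes f: "continuous_on UNIV f" and m: "m \<ge> 1" and e: "e > 0"
  shows "\<exists>h>0. \<exists>g\<in>uniform_splines m h. \<forall>x. \<bar>x\<bar> \<le> R \<longrightarrow> \<bar>g x - f x\<bar> \<le> e"
proof -
  \<comment> \<open>The margin \<open>m\<close> leaves room for the sample points, which may lie up
    to \<open>h * m \<le> m\<close> to the left of \<open>x\<close>.\<close>
  define S where "S = {-\<bar>R\<bar> - real m..\<bar>R\<bar> + real m}"
  have "uniformly_continuous_on S f"
    unfolding S_def using f continuous_on_subset by (intro compact_uniformly_continuous) auto
  then obtain d where d: "d > 0" "\<And>x y. x \<in> S \<Longrightarrow> y \<in> S \<Longrightarrow> dist y x < d \<Longrightarrow> dist (f y) (f x) < e"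
    using e unfolding uniformly_continuous_on_def by metis
  define h where "h = min 1 (d / (real m + 1))"
  have h: "h > 0" "h \<le> 1" "h * real m < d"
  proof -
    show "h > 0" "h \<le> 1" using d(1) by (auto simp: h_def)
    have "h * real m \<le> d / (real m + 1) * real m" unfolding h_def by (intro mult_right_mono) auto
    also have "\<dots> < d" using d(1) by (simp add: field_simps)
    finally show "h * real m < d" .
  qed
  \<comment> \<open>This window contains every index whose spline is nonzero somewhere on
    \<open>[-\<bar>R\<bar>, \<bar>R\<bar>]\<close>.\<close>
  define i where "i = \<lfloor>- \<bar>R\<bar> / h - real m\<rfloor>"
  define j where "j = \<lceil>\<bar>R\<bar> / h\<rceil>"
  define g where "g x = (\<Sum>k\<in>{i..j}. f (h * of_int k) * cardinal_bspline m (x / h - of_int k))" for x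
  have "\<bar>g x - f x\<bar> \<le> e" if x: "\<bar>x\<bar> \<le> R" for x
  proof -
    have "- \<bar>R\<bar> / h \<le> x / h" "x / h \<le> \<bar>R\<bar> / h"
      by (rule divide_right_mono; use x h(1) in linarith)+
    then have ij: "of_int i \<le> x / h - real m" "x / h \<le> of_int j"
      unfolding i_def j_def by linarith+
    have unity: "(\<Sum>k\<in>{i..j}. cardinal_bspline m (x / h - of_int k)) = 1"
      by (rule cardinal_bspline_partition_of_unity[OF m ij])
    have "g x - f x = g x - f x * (\<Sum>k\<in>{i..j}. cardinal_bspline m (x / h - of_int k))"
      using unity by simp
    also have "\<dots> = (\<Sum>k\<in>{i..j}. (f (h * of_int k) - f x) * cardinal_bspline m (x / h - of_int k))"
      by (simp add: g_def sum_distrib_left sum_subtractf[symmetric] algebra_simps)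
    also have "\<bar>\<dots>\<bar> \<le> (\<Sum>k\<in>{i..j}. e * cardinal_bspline m (x / h - of_int k))"
    proof (rule order_trans[OF sum_abs], rule sum_mono)
      fix k
      have nonneg: "cardinal_bspline m (x / h - of_int k) \<ge> 0" by (rule cardinal_bspline_nonneg[OF m])
      show "\<bar>(f (h * of_int k) - f x) * cardinal_bspline m (x / h - of_int k)\<bar> \<le> e * cardinal_bspline m (x / h - of_int k)"
      proof (cases "x / h - of_int k < 0 \<or> real m \<le> x / h - of_int k")
        case True
        then show ?thesis using cardinal_bspline_eq_0[OF m True] by simp
      next
        case False
        then have k: "h * of_int k \<le> x" "x \<le> h * of_int k + h * real m"
          using h(1) by (auto simp: field_simps)
        moreover have "h * real m \<le> real m" using h by (simp add: mult_left_le_one_le)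
        ultimately have "h * of_int k \<in> S" "x \<in> S" using x by (auto simp: S_def)
        then have "\<bar>f (h * of_int k) - f x\<bar> \<le> e"
          using d(2)[of x "h * of_int k"] k h(3) by (auto simp: dist_real_def)
        then show ?thesis using nonneg by (simp add: abs_mult mult_right_mono)
      qed
    qed
    also have "\<dots> = e" using unity by (simp add: sum_distrib_left[symmetric])
    finally show ?thesis .
  qed
  moreover have "g \<in> uniform_splines m h" unfolding g_def[abs_def] by (rule uniform_splinesI) simp
  ultimately show ?thesis using h(1) by blast
qed

section \<open>Expansion of Cauchy integrals at the origin\<close>

lemma cauchy_kernel_expansion:
  fixes \<xi> z :: complex
  assumes "\<xi> \<noteq> 0" "\<xi> \<noteq> z"
  shows "1 / (\<xi> - z) - (\<Sum>j\<le>n. z ^ j / \<xi> ^ Suc j) = z ^ Suc n / (\<xi> ^ Suc n * (\<xi> - z))"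
proof (induction n)
  case 0
  then show ?case using assms by (simp add: field_simps)
next
  case (Suc n)
  have "1 / (\<xi> - z) - (\<Sum>j\<le>Suc n. z ^ j / \<xi> ^ Suc j) =
      z ^ Suc n / (\<xi> ^ Suc n * (\<xi> - z)) - z ^ Suc n / \<xi> ^ Suc (Suc n)"
    using Suc by simp
  also have "\<dots> = z ^ Suc (Suc n) / (\<xi> ^ Suc (Suc n) * (\<xi> - z))"
    using assms by (simp add: divide_simps) (simp add: algebra_simps)
  finally show ?case .
qed

text \<open>The geometric expansion of the kernel is integrated against \<open>g\<close>. Its
  remainder contains the factor \<open>g \<xi> / \<xi> ^ Suc n\<close>, so for
  \<open>g \<ge> 0\<close> the error is measured by the last coefficient itself, times a factor that
  is small for large \<open>A\<close>.\<close>

lemma cauchy_int_moment_expansion: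
  fixes g :: "real \<Rightarrow> real"
  assumes cont: "continuous_on {A..B} g" and supp: "\<And>x. x \<notin> {A..B} \<Longrightarrow> g x = 0" and nonneg: "\<And>x. g x \<ge> 0"
    and r: "r < A" "norm z \<le> r" and z: "Im z \<noteq> 0"
  shows "norm (cauchy_int g z - (\<Sum>j\<le>n. of_real (integral {A..B} (\<lambda>\<xi>. g \<xi> / \<xi> ^ Suc j)) * z ^ j)) \<le>
    integral {A..B} (\<lambda>\<xi>. g \<xi> / \<xi> ^ Suc n) * (r ^ Suc n / (A - r))"
proof -
  have r0: "r \<ge> 0" using r(2) norm_ge_zero order_trans by blast
  have pos: "\<xi> > 0" if "\<xi> \<in> {A..B}" for \<xi> using that r r0 by auto
  have nz: "complex_of_real \<xi> - z \<noteq> 0" for \<xi> by (rule of_real_diff_nonzero[OF z])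
  have int_real: "(\<lambda>\<xi>. g \<xi> / \<xi> ^ Suc j) integrable_on {A..B}" for j
    using pos by (intro integrable_continuous_real continuous_intros cont) force
  have moment: "((\<lambda>\<xi>. complex_of_real (g \<xi> / \<xi> ^ Suc j) * z ^ j) has_integral
      of_real (integral {A..B} (\<lambda>\<xi>. g \<xi> / \<xi> ^ Suc j)) * z ^ j) {A..B}" for j
    by (intro has_integral_mult_left has_integral_of_real integrable_integral int_real)
  have cont_kernel: "continuous_on {A..B} (\<lambda>\<xi>. complex_of_real (g \<xi>) / (complex_of_real \<xi> - z))"
    by (intro continuous_intros cont ballI nz)
  have "cauchy_int g z = integral {A..B} (\<lambda>\<xi>. complex_of_real (g \<xi>) / (complex_of_real \<xi> - z))"
    unfolding cauchy_int_def by (rule compact_support_integral[OF cont_kernel]) (simp add: supp)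
  then have kernel: "((\<lambda>\<xi>. complex_of_real (g \<xi>) / (complex_of_real \<xi> - z)) has_integral cauchy_int g z) {A..B}"
    using integrable_integral[OF integrable_continuous_real[OF cont_kernel]] by simp
  define D where "D \<xi> = complex_of_real (g \<xi>) / (complex_of_real \<xi> - z) - (\<Sum>j\<le>n. complex_of_real (g \<xi> / \<xi> ^ Suc j) * z ^ j)" for \<xi>
  have D: "(D has_integral (cauchy_int g z - (\<Sum>j\<le>n. of_real (integral {A..B} (\<lambda>\<xi>. g \<xi> / \<xi> ^ Suc j)) * z ^ j))) {A..B}"
    unfolding D_def[abs_def] by (intro has_integral_diff kernel has_integral_sum moment) auto
  have bound: "norm (D \<xi>) \<le> g \<xi> / \<xi> ^ Suc n * (r ^ Suc n / (A - r))" if \<xi>: "\<xi> \<in> {A..B}" for \<xi>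
  proof -
    have "D \<xi> = complex_of_real (g \<xi>) * (1 / (complex_of_real \<xi> - z) - (\<Sum>j\<le>n. z ^ j / complex_of_real \<xi> ^ Suc j))"
      by (simp add: D_def right_diff_distrib sum_distrib_left)
    also have "\<dots> = complex_of_real (g \<xi>) * (z ^ Suc n / (complex_of_real \<xi> ^ Suc n * (complex_of_real \<xi> - z)))"
      using pos[OF \<xi>] nz[of \<xi>] by (subst cauchy_kernel_expansion) auto
    finally have "norm (D \<xi>) = g \<xi> / \<xi> ^ Suc n * (norm z ^ Suc n / norm (complex_of_real \<xi> - z))"
      using nonneg[of \<xi>] pos[OF \<xi>] by (simp add: norm_mult norm_divide norm_power)
    also have "\<dots> \<le> g \<xi> / \<xi> ^ Suc n * (r ^ Suc n / (A - r))"
    proof (intro mult_left_mono frac_le power_mono)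
      show "A - r \<le> norm (complex_of_real \<xi> - z)"
        using norm_triangle_ineq2[of "complex_of_real \<xi>" z] \<xi> r by auto
    qed (use r r0 nonneg pos[OF \<xi>] in auto)
    finally show ?thesis .
  qed
  have "norm (integral {A..B} D) \<le> integral {A..B} (\<lambda>\<xi>. g \<xi> / \<xi> ^ Suc n * (r ^ Suc n / (A - r)))"
    using D bound int_real
    by (intro Henstock_Kurzweil_Integration.integral_norm_bound_integral integrable_on_mult_left) (auto simp: integrable_on_def)
  then show ?thesis unfolding integral_unique[OF D] Henstock_Kurzweil_Integration.integral_mult_left .
qed

text \<open>A spline that vanished identically would contradict the partition of unity at
  \<open>0\<close>.\<close>

lemma cardinal_bspline_not_zero:
  assumes "m \<ge> 1"
  shows "\<exists>t. cardinal_bspline m t > 0"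
proof (rule ccontr)
  assume "\<nexists>t. cardinal_bspline m t > 0"
  then have "cardinal_bspline m t = 0" for t
    using cardinal_bspline_nonneg[OF assms, of t] by (meson antisym_conv not_less)
  moreover have "(\<Sum>k\<in>{- int m..0}. cardinal_bspline m (0 - of_int k)) = 1"
    by (rule cardinal_bspline_partition_of_unity[OF assms]) auto
  ultimately show False by simp
qed

text \<open>Permits division by the leading coefficient of the expansion: the integrand is
  continuous and nonnegative and does not vanish at the image of a point where the spline is
  positive.\<close>

lemma bspline_moment_pos:
  assumes m: "m \<ge> 2" and h: "h > 0" and k: "k > 0"
  shows "integral {h * of_int k..h * (of_int k + real m)}
    (\<lambda>\<xi>. cardinal_bspline m (\<xi> / h - of_int k) / \<xi> ^ j) > 0"
proof -
  let ?A = "h * of_int k" and ?B = "h * (of_int k + real m)"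
  let ?f = "\<lambda>\<xi>. cardinal_bspline m (\<xi> / h - of_int k) / \<xi> ^ j"
  have m1: "m \<ge> 1" using m by simp
  have A: "?A > 0" using h k by simp
  obtain L where "L-lipschitz_on UNIV (cardinal_bspline m)" using cardinal_bspline_lipschitz[OF m] ..
  then have c: "continuous_on UNIV (cardinal_bspline m)" by (rule lipschitz_on_continuous_on)
  have "continuous_on {?A..?B} (\<lambda>\<xi>. cardinal_bspline m (\<xi> / h - of_int k))"
    by (rule continuous_on_compose2[OF c]) (use h in \<open>auto intro!: continuous_intros\<close>)
  then have cont: "continuous_on {?A..?B} ?f"
    using A by (intro continuous_on_divide continuous_intros) auto
  have nonneg: "?f \<xi> \<ge> 0" if "\<xi> \<in> {?A..?B}" for \<xi>
    using that A cardinal_bspline_nonneg[OF m1] by (intro divide_nonneg_nonneg) auto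
  obtain t where t: "cardinal_bspline m t > 0" using cardinal_bspline_not_zero[OF m1] ..
  then have "0 \<le> t" "t < real m" using cardinal_bspline_eq_0[OF m1, of t] by force+
  then have in_AB: "h * (of_int k + t) \<in> {?A..?B}" and "?A < ?B" using h m by (auto simp: mult_strict_left_mono)
  moreover have "?f (h * (of_int k + t)) \<noteq> 0" using t h k \<open>0 \<le> t\<close> by simp
  ultimately have "integral {?A..?B} ?f \<noteq> 0"
    using integral_eq_0_iff[OF cont _ nonneg] by metis
  moreover have "integral {?A..?B} ?f \<ge> 0"
    using nonneg by (intro Henstock_Kurzweil_Integration.integral_nonneg integrable_continuous_real cont)
  ultimately show ?thesis by simp
qed

section \<open>Uniform density of boundary values\<close>

text \<open>The mesh \<open>h\<close> is common to all \<open>e\<close>; approximants can therefore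
  be added without leaving \<open>uniform_splines m h\<close>.\<close>

definition spline_approximable :: "nat \<Rightarrow> real \<Rightarrow> real set \<Rightarrow> (real \<Rightarrow> complex) \<Rightarrow> bool" where
  "spline_approximable m h \<Omega> F \<longleftrightarrow> (\<forall>e>0. \<exists>g\<in>uniform_splines m h. \<forall>x\<in>\<Omega>.
     norm (boundary_value (cauchy_int g) (of_real x) - F x) \<le> e)"

lemma spline_approximable_self:
  "g \<in> uniform_splines m h \<Longrightarrow> spline_approximable m h \<Omega> (\<lambda>x. boundary_value (cauchy_int g) (of_real x))"
  unfolding spline_approximable_def by (intro allI impI bexI[of _ g]) simp_all

lemma spline_approximable_limit:
  assumes "\<And>e. e > 0 \<Longrightarrow> \<exists>F'. spline_approximable m h \<Omega> F' \<and> (\<forall>x\<in>\<Omega>. norm (F' x - F x) \<le> e)"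
  shows "spline_approximable m h \<Omega> F"
  unfolding spline_approximable_def
proof (intro allI impI)
  fix e :: real assume e: "e > 0"
  then obtain F' where F': "spline_approximable m h \<Omega> F'" "\<And>x. x \<in> \<Omega> \<Longrightarrow> norm (F' x - F x) \<le> e / 2"
    using assms[of "e / 2"] by auto
  moreover obtain g where "g \<in> uniform_splines m h"
      "\<And>x. x \<in> \<Omega> \<Longrightarrow> norm (boundary_value (cauchy_int g) (of_real x) - F' x) \<le> e / 2"
    using F'(1) e unfolding spline_approximable_def by (meson half_gt_zero)
  ultimately show "\<exists>g\<in>uniform_splines m h. \<forall>x\<in>\<Omega>. norm (boundary_value (cauchy_int g) (of_real x) - F x) \<le> e"
    using norm_diff_triangle_le[of _ _ "e / 2" _ "e / 2"] by (metis field_sum_of_halves)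
qed

lemma spline_approximable_lincomb:
  assumes F: "spline_approximable m h \<Omega> F" and F': "spline_approximable m h \<Omega> F'" and m: "m \<ge> 2" and h: "h > 0"
  shows "spline_approximable m h \<Omega> (\<lambda>x. of_real a * F x + of_real a' * F' x)"
  unfolding spline_approximable_def
proof (intro allI impI)
  fix e :: real assume e: "e > 0"
  define d where "d = e / (\<bar>a\<bar> + \<bar>a'\<bar> + 1)"
  have d: "d > 0" using e by (simp add: d_def)
  obtain g where g: "g \<in> uniform_splines m h"
      "\<And>x. x \<in> \<Omega> \<Longrightarrow> norm (boundary_value (cauchy_int g) (of_real x) - F x) \<le> d"
    using F d unfolding spline_approximable_def by meson
  obtain g' where g': "g' \<in> uniform_splines m h"
      "\<And>x. x \<in> \<Omega> \<Longrightarrow> norm (boundary_value (cauchy_int g') (of_real x) - F' x) \<le> d"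
    using F' d unfolding spline_approximable_def by meson
  have m1: "m \<ge> 1" using m by simp
  obtain M M' R R' where lip: "M-lipschitz_on UNIV g" "M'-lipschitz_on UNIV g'"
      and supp: "\<And>x. \<bar>x\<bar> > R \<Longrightarrow> g x = 0" "\<And>x. \<bar>x\<bar> > R' \<Longrightarrow> g' x = 0"
    using uniform_splines_lipschitz[OF g(1) m] uniform_splines_lipschitz[OF g'(1) m]
      uniform_splines_support[OF g(1) m1 h] uniform_splines_support[OF g'(1) m1 h] by blast
  have "norm (boundary_value (cauchy_int (\<lambda>x. a * g x + a' * g' x)) (of_real x) - (of_real a * F x + of_real a' * F' x)) \<le> e"
    if x: "x \<in> \<Omega>" for x
  proof -
    let ?b = "boundary_value (cauchy_int g) (of_real x)" and ?b' = "boundary_value (cauchy_int g') (of_real x)"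
    have "boundary_value (cauchy_int (\<lambda>x. a * g x + a' * g' x)) (of_real x) - (of_real a * F x + of_real a' * F' x) =
        of_real a * (?b - F x) + of_real a' * (?b' - F' x)"
      by (subst boundary_value_cauchy_int_lincomb[OF lip(1) supp(1) lip(2) supp(2)]) (simp_all add: algebra_simps)
    also have "norm \<dots> \<le> \<bar>a\<bar> * norm (?b - F x) + \<bar>a'\<bar> * norm (?b' - F' x)"
      by (rule order_trans[OF norm_triangle_ineq]) (simp add: norm_mult)
    also have "\<dots> \<le> \<bar>a\<bar> * d + \<bar>a'\<bar> * d"
      using g(2)[OF x] g'(2)[OF x] by (intro add_mono mult_left_mono) auto
    also have "\<dots> \<le> (\<bar>a\<bar> + \<bar>a'\<bar> + 1) * d" using d by (simp add: algebra_simps)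
    also have "\<dots> = e" by (simp add: d_def)
    finally show ?thesis .
  qed
  then show "\<exists>g\<in>uniform_splines m h. \<forall>x\<in>\<Omega>.
      norm (boundary_value (cauchy_int g) (of_real x) - (of_real a * F x + of_real a' * F' x)) \<le> e"
    using uniform_splines_lincomb[OF g(1) g'(1)] by blast
qed

lemma spline_approximable_sum:
  assumes "finite J" "\<And>j. j \<in> J \<Longrightarrow> spline_approximable m h \<Omega> (F j)" "m \<ge> 2" "h > 0"
  shows "spline_approximable m h \<Omega> (\<lambda>x. \<Sum>j\<in>J. of_real (a j) * F j x)"
  using assms(1,2)
proof (induction J)
  case empty
  \<comment> \<open>The zero function arises as a combination with coefficients 0 of an arbitrary
    approximable function, here the one of the empty spline.\<close>
  have "spline_approximable m h \<Omega> (\<lambda>x. boundary_value (cauchy_int (\<lambda>x. \<Sum>k\<in>{}. 0 * cardinal_bspline m (x / h - of_int k))) (of_real x))"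
    by (intro spline_approximable_self uniform_splinesI) simp
  from spline_approximable_lincomb[OF this this assms(3,4), of 0 0] show ?case by simp
next
  case (insert j J)
  from spline_approximable_lincomb[OF insert.prems[OF insertI1] insert.IH assms(3,4), of "a j" 1]
  show ?case using insert by simp
qed

text \<open>A single B-spline far to the right has boundary value
  \<open>\<Sum>j\<le>n. a j * x ^ j\<close> up to the error \<open>a n * e\<close>. Subtracting the
  lower powers, approximable by induction, and dividing by \<open>a n\<close> leaves
  \<open>x ^ n\<close> up to \<open>e\<close>.\<close>

lemma spline_approximable_power:
  assumes m: "m \<ge> 2" and h: "h > 0" and r: "\<And>x. x \<in> \<Omega> \<Longrightarrow> \<bar>x\<bar> \<le> r"
  shows "spline_approximable m h \<Omega> (\<lambda>x. of_real x ^ n)"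
proof (induction n rule: less_induct)
  case (less n)
  show ?case
  proof (rule spline_approximable_limit)
    fix e :: real assume e: "e > 0"
    \<comment> \<open>The added 1 leaves room for the vertical shifts in the definition of the
      boundary value.\<close>
    define r' where "r' = \<bar>r\<bar> + 1"
    \<comment> \<open>With mesh \<open>h\<close> given, the spline is moved right by whole steps
      until \<open>r' ^ Suc n / (A - r') \<le> e\<close>.\<close>
    obtain N :: nat where N: "(r' + r' ^ Suc n / e) / h < real N" using reals_Archimedean2 by blast
    define k where "k = int N + 1"
    define A where "A = h * of_int k"
    define B where "B = h * (of_int k + real m)"
    have "k > 0" by (simp add: k_def)
    have "r' + r' ^ Suc n / e < h * real N" using N h by (simp add: divide_less_eq mult.commute)
    also have "\<dots> \<le> A" using h by (simp add: A_def k_def)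
    finally have A: "r' + r' ^ Suc n / e < A" .
    have r'_pos: "r' ^ Suc n / e > 0" using e by (simp add: r'_def add_nonneg_pos)
    have small: "r' ^ Suc n / (A - r') \<le> e"
    proof -
      have "A - r' > 0" using A r'_pos by linarith
      moreover have "r' ^ Suc n \<le> e * (A - r')" using A e by (simp add: field_simps)
      ultimately show ?thesis by (simp add: divide_le_eq)
    qed
    define g where "g x = cardinal_bspline m (x / h - of_int k)" for x
    have g: "g \<in> uniform_splines m h"
      using uniform_splinesI[of "{k}" "\<lambda>_. 1" m h] by (simp add: g_def[abs_def])
    have m1: "m \<ge> 1" using m by simp
    obtain M R where M: "M-lipschitz_on UNIV g" and R: "\<And>x. \<bar>x\<bar> > R \<Longrightarrow> g x = 0"
      using uniform_splines_lipschitz[OF g m] uniform_splines_support[OF g m1 h] by blast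
    have cont: "continuous_on {A..B} g"
      using lipschitz_on_continuous_on[OF M] continuous_on_subset by blast
    have supp: "g x = 0" if "x \<notin> {A..B}" for x
      unfolding g_def using that h by (intro cardinal_bspline_eq_0 m1) (auto simp: A_def B_def field_simps)
    have nonneg: "g x \<ge> 0" for x unfolding g_def by (rule cardinal_bspline_nonneg[OF m1])
    define a where "a j = integral {A..B} (\<lambda>\<xi>. g \<xi> / \<xi> ^ Suc j)" for j
    have a_pos: "a n > 0"
      unfolding a_def g_def A_def B_def by (rule bspline_moment_pos[OF m h \<open>k > 0\<close>])
    define b where "b x = boundary_value (cauchy_int g) (of_real x)" for x
    have expansion: "norm (b x - (\<Sum>j\<le>n. of_real (a j) * of_real x ^ j)) \<le> a n * e" if x: "x \<in> \<Omega>" for x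
    proof (rule LIMSEQ_le_const2)
      let ?u = "\<lambda>n. of_real x + \<i> * complex_of_real (inverse (real (Suc n)))"
      show "(\<lambda>i. norm (cauchy_int g (?u i) - (\<Sum>j\<le>n. of_real (a j) * ?u i ^ j)))
        \<longlonglongrightarrow> norm (b x - (\<Sum>j\<le>n. of_real (a j) * of_real x ^ j))"
        unfolding b_def
        by (intro tendsto_intros shift_tendsto boundary_value_tendsto[of "1/2"] cauchy_int_half_plane_holder[OF M R]) auto
      have "norm (cauchy_int g (?u i) - (\<Sum>j\<le>n. of_real (a j) * ?u i ^ j)) \<le> a n * (r' ^ Suc n / (A - r'))" for i
        unfolding a_def
      proof (rule cauchy_int_moment_expansion[OF cont supp nonneg])
        show "r' < A" using A r'_pos by linarith
        show "norm (?u i) \<le> r'" using norm_shift_le[of "of_real x" i] r[OF x] by (simp add: r'_def)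
        show "Im (?u i) \<noteq> 0" using Im_shift_pos[of "of_real x" i] by simp
      qed
      also have "a n * (r' ^ Suc n / (A - r')) \<le> a n * e" using small a_pos by (intro mult_left_mono) auto
      finally show "\<exists>N. \<forall>i\<ge>N. norm (cauchy_int g (?u i) - (\<Sum>j\<le>n. of_real (a j) * ?u i ^ j)) \<le> a n * e"
        by blast
    qed
    define F' where "F' x = of_real (1 / a n) * b x + of_real (-1) * (\<Sum>j<n. of_real (a j / a n) * of_real x ^ j)" for x
    have "spline_approximable m h \<Omega> F'"
      unfolding F'_def[abs_def] b_def
      by (intro spline_approximable_lincomb spline_approximable_self g m h
          spline_approximable_sum[where F = "\<lambda>j x. of_real x ^ j"] less) auto
    moreover have "norm (F' x - of_real x ^ n) \<le> e" if x: "x \<in> \<Omega>" for x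
    proof -
      define S where "S = (\<Sum>j<n. of_real (a j / a n) * complex_of_real x ^ j)"
      have F'_eq: "F' x = b x / of_real (a n) - S" by (simp add: F'_def S_def)
      have S_eq: "of_real (a n) * S = (\<Sum>j<n. of_real (a j) * complex_of_real x ^ j)"
        using a_pos by (simp add: S_def sum_distrib_left)
      have "of_real (a n) * (F' x - of_real x ^ n) = b x - of_real (a n) * S - of_real (a n) * of_real x ^ n"
        using a_pos by (simp add: F'_eq right_diff_distrib)
      also have "\<dots> = b x - (\<Sum>j\<le>n. of_real (a j) * of_real x ^ j)"
        unfolding S_eq by (simp add: lessThan_Suc_atMost[symmetric])
      finally have "of_real (a n) * (F' x - of_real x ^ n) = b x - (\<Sum>j\<le>n. of_real (a j) * of_real x ^ j)" .
      then have "a n * norm (F' x - of_real x ^ n) = norm (b x - (\<Sum>j\<le>n. of_real (a j) * of_real x ^ j))"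
        using a_pos by (metis abs_of_pos norm_mult norm_of_real)
      also have "\<dots> \<le> a n * e" by (rule expansion[OF x])
      finally show ?thesis using a_pos by simp
    qed
    ultimately show "\<exists>F'. spline_approximable m h \<Omega> F' \<and> (\<forall>x\<in>\<Omega>. norm (F' x - of_real x ^ n) \<le> e)" by blast
  qed
qed

lemma spline_approximable_continuous_real:
  assumes m: "m \<ge> 2" and h: "h > 0" and \<Omega>: "compact \<Omega>" and f: "continuous_on \<Omega> f"
  shows "spline_approximable m h \<Omega> (\<lambda>x. of_real (f x))"
proof (rule spline_approximable_limit)
  fix e :: real assume "e > 0"
  then obtain P where P: "real_polynomial_function P" "\<And>x. x \<in> \<Omega> \<Longrightarrow> \<bar>f x - P x\<bar> < e"
    using Stone_Weierstrass_real_polynomial_function[OF \<Omega> f] by blast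
  obtain a n where a: "P = (\<lambda>x. \<Sum>i\<le>n. a i * x ^ i)"
    using P(1) real_polynomial_function_iff_sum by blast
  obtain r where r: "\<And>x. x \<in> \<Omega> \<Longrightarrow> \<bar>x\<bar> \<le> r"
    using compact_imp_bounded[OF \<Omega>] by (auto simp: bounded_real)
  have "spline_approximable m h \<Omega> (\<lambda>x. \<Sum>i\<le>n. of_real (a i) * of_real x ^ i)"
    by (intro spline_approximable_sum[where F = "\<lambda>j x. of_real x ^ j"] spline_approximable_power[OF m h r] m h) auto
  moreover have "norm ((\<Sum>i\<le>n. of_real (a i) * of_real x ^ i) - complex_of_real (f x)) \<le> e" if "x \<in> \<Omega>" for x
  proof -
    have "(\<Sum>i\<le>n. of_real (a i) * of_real x ^ i) - complex_of_real (f x) = of_real (P x - f x)" by (simp add: a)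
    then have "norm ((\<Sum>i\<le>n. of_real (a i) * of_real x ^ i) - complex_of_real (f x)) = \<bar>P x - f x\<bar>"
      by (metis norm_of_real)
    then show ?thesis using P(2)[OF that] by linarith
  qed
  ultimately show "\<exists>F'. spline_approximable m h \<Omega> F' \<and> (\<forall>x\<in>\<Omega>. norm (F' x - of_real (f x)) \<le> e)" by blast
qed

section \<open>Approximation by members of \<open>W_m\<close>\<close>

lemma boundary_value_in_W_m:
  assumes g: "g \<in> uniform_splines m h" and m: "m \<ge> 2" and h: "h > 0" and \<alpha>: "0 < \<alpha>" "\<alpha> < 1" and \<Omega>: "compact \<Omega>"
  shows "(\<lambda>x. boundary_value (cauchy_int g) (of_real x)) \<in> W_m m \<alpha> \<Omega>"
proof -
  have m1: "m \<ge> 1" using m by simp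
  obtain M R where M: "M-lipschitz_on UNIV g" and R: "\<And>x. \<bar>x\<bar> > R \<Longrightarrow> g x = 0"
    using uniform_splines_lipschitz[OF g m] uniform_splines_support[OF g m1 h] by blast
  have cont: "continuous_on {-R..R} g"
    using lipschitz_on_continuous_on[OF M] continuous_on_subset by blast
  have hp: "half_plane_holder \<alpha> (cauchy_int g)" by (rule cauchy_int_half_plane_holder[OF M R \<alpha>])
  have holder: "holder_on \<alpha> \<Omega> (\<lambda>x. boundary_value (cauchy_int g) (of_real x))"
  proof -
    have "loc_holder_on \<alpha> (complex_of_real ` \<Omega>) (boundary_value (cauchy_int g))"
      by (rule boundary_value_loc_holder[OF hp \<alpha>(1)]) auto
    moreover have "compact (complex_of_real ` \<Omega>)"
      using \<Omega> by (intro compact_continuous_image continuous_intros)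
    ultimately have "holder_on \<alpha> (complex_of_real ` \<Omega>) (boundary_value (cauchy_int g))"
      unfolding loc_holder_on_def by blast
    then show ?thesis by (auto simp: holder_on_def dist_of_real)
  qed
  have "holder_qh_extension \<alpha> \<Omega> (\<lambda>x. boundary_value (cauchy_int g) (of_real x)) (cauchy_int g)"
    unfolding holder_qh_extension_def
  \<comment> \<open>The extension exists up to the entire real axis, so the neighborhood of
    \<open>\<Omega>\<close> can be the whole line.\<close>
  proof (intro conjI exI[of _ UNIV] exI[of _ "boundary_value (cauchy_int g)"])
    show "quasi_herglotz (cauchy_int g)" by (rule cauchy_int_quasi_herglotz[OF cont R])
    show "loc_holder_on \<alpha> (upper_half_plane \<union> complex_of_real ` closure UNIV) (boundary_value (cauchy_int g))"
      by (rule boundary_value_loc_holder[OF hp \<alpha>(1)]) (auto simp: upper_half_plane_def)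
    show "\<forall>z\<in>upper_half_plane. boundary_value (cauchy_int g) z = cauchy_int g z"
      using boundary_value_eq[OF hp \<alpha>(1)] by (auto simp: upper_half_plane_def)
  qed auto
  moreover have "\<exists>a b \<beta>'. uniform_bspline_expansion m \<beta>' \<and>
      (\<forall>z\<in>upper_half_plane. cauchy_int g z = complex_of_real a + complex_of_real b * z +
        (LINT \<xi>|lborel. (1 / (complex_of_real \<xi> - z) - complex_of_real (\<xi> / (1 + \<xi>\<^sup>2))) * complex_of_real (\<beta>' \<xi>)))"
  proof (intro exI conjI ballI)
    show "uniform_bspline_expansion m g" by (rule uniform_splines_expansion[OF g h])
    fix z assume "z \<in> upper_half_plane"
    then have z: "Im z \<noteq> 0" by (simp add: upper_half_plane_def)
    have "\<xi>\<^sup>2 + 1 \<noteq> 0" for \<xi> :: real by (smt (verit) zero_le_power2)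
    then have "continuous_on {-R..R} (\<lambda>\<xi>. \<xi> / (1 + \<xi>\<^sup>2) * g \<xi>)"
      by (intro continuous_intros cont) (auto simp: add.commute)
    then have int: "integrable lborel (\<lambda>\<xi>. \<xi> / (1 + \<xi>\<^sup>2) * g \<xi>)"
      by (rule compact_support_integral(1)) (use R in force)
    have "(LINT \<xi>|lborel. (1 / (complex_of_real \<xi> - z) - complex_of_real (\<xi> / (1 + \<xi>\<^sup>2))) * complex_of_real (g \<xi>)) =
      (LINT \<xi>|lborel. complex_of_real (g \<xi>) / (complex_of_real \<xi> - z) - complex_of_real (\<xi> / (1 + \<xi>\<^sup>2) * g \<xi>))"
      by (simp add: left_diff_distrib)
    also have "\<dots> = cauchy_int g z - complex_of_real (LINT \<xi>|lborel. \<xi> / (1 + \<xi>\<^sup>2) * g \<xi>)"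
      using cauchy_int_integrable[OF cont R z] int unfolding cauchy_int_def
      by (subst Bochner_Integration.integral_diff) (simp_all only: integrable_of_real integral_complex_of_real)
    \<comment> \<open>The real constant \<open>a\<close> compensates the term
      \<open>\<xi> / (1 + \<xi>\<^sup>2)\<close> of the kernel, and the linear coefficient is
      \<open>0\<close>.\<close>
    finally show "cauchy_int g z = complex_of_real (LINT \<xi>|lborel. \<xi> / (1 + \<xi>\<^sup>2) * g \<xi>) + complex_of_real 0 * z +
      (LINT \<xi>|lborel. (1 / (complex_of_real \<xi> - z) - complex_of_real (\<xi> / (1 + \<xi>\<^sup>2))) * complex_of_real (g \<xi>))"
      by simp
  qed
  ultimately show ?thesis unfolding W_m_def using holder by blast
qed

lemma holder_on_imp_continuous_on:
  assumes "holder_on \<alpha> S f" "\<alpha> > 0"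
  shows "continuous_on S f"
proof -
  obtain C where C: "\<And>x y. x \<in> S \<Longrightarrow> y \<in> S \<Longrightarrow> dist (f x) (f y) \<le> C * dist x y powr \<alpha>"
    using assms(1) unfolding holder_on_def by blast
  show ?thesis
    unfolding continuous_on_def
  proof
    fix x assume x: "x \<in> S"
    have "((\<lambda>y. C * dist y x powr \<alpha>) \<longlongrightarrow> C * dist x x powr \<alpha>) (at x within S)"
      using assms(2) by (intro tendsto_intros tendsto_powr') auto
    then have "((\<lambda>y. C * dist y x powr \<alpha>) \<longlongrightarrow> 0) (at x within S)" using assms(2) by simp
    then have "((\<lambda>y. dist (f y) (f x)) \<longlongrightarrow> 0) (at x within S)"
      by (rule Lim_null_comparison[rotated]) (use C x in \<open>auto simp: eventually_at_filter\<close>)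
    then show "(f \<longlongrightarrow> f x) (at x within S)" by (subst tendsto_dist_iff)
  qed
qed

text \<open>A first spline \<open>g\<close> settles the imaginary part and thereby the mesh
  \<open>h\<close>. Its error in the real part is a real continuous function, which is approximable
  with the same \<open>h\<close>, so the combined density is again a uniform expansion.\<close>

lemma W_m_uniformly_dense:
  assumes m: "m \<ge> 2" and \<alpha>: "0 < \<alpha>" "\<alpha> < 1" and \<Omega>: "compact \<Omega>" and F: "continuous_on \<Omega> F" and e: "e > 0"
  shows "\<exists>q\<in>W_m m \<alpha> \<Omega>. \<forall>x\<in>\<Omega>. norm (q x - F x) \<le> e"
proof -
  have m1: "m \<ge> 1" using m by simp
  obtain r where r: "\<And>x. x \<in> \<Omega> \<Longrightarrow> \<bar>x\<bar> \<le> r"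
    using compact_imp_bounded[OF \<Omega>] by (auto simp: bounded_real)
  \<comment> \<open>One \<open>d\<close> is spent on the polynomial and one on the spline; the
    factor \<open>pi\<close> of the boundary value turns \<open>2 * d\<close> into
    \<open>e / 2\<close>.\<close>
  define d where "d = e / (4 * pi)"
  have d: "d > 0" using e by (simp add: d_def)
  have "continuous_on \<Omega> (\<lambda>x. Im (F x) / pi)" by (intro continuous_intros F) auto
  \<comment> \<open>The polynomial serves as a substitute for \<open>Im F / pi\<close> that is
    continuous on the whole line, as \<open>uniform_splines_approx\<close> requires;
    \<open>F\<close> is controlled on \<open>\<Omega>\<close> only.\<close>
  then obtain P where P: "real_polynomial_function P" "\<And>x. x \<in> \<Omega> \<Longrightarrow> \<bar>Im (F x) / pi - P x\<bar> < d"
    using Stone_Weierstrass_real_polynomial_function[OF \<Omega>, of "\<lambda>x. Im (F x) / pi" d] d by auto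
  have "continuous_on UNIV P"
    using P(1) by (intro continuous_on_polymonial_function) (simp add: real_polynomial_function_eq)
  then obtain h g where h: "h > 0" and g: "g \<in> uniform_splines m h" "\<And>x. \<bar>x\<bar> \<le> r \<Longrightarrow> \<bar>g x - P x\<bar> \<le> d"
    using uniform_splines_approx[of P m d r] m1 d by auto
  obtain M R where M: "M-lipschitz_on UNIV g" and R: "\<And>x. \<bar>x\<bar> > R \<Longrightarrow> g x = 0"
    using uniform_splines_lipschitz[OF g(1) m] uniform_splines_support[OF g(1) m1 h] by blast
  define b where "b x = boundary_value (cauchy_int g) (of_real x)" for x
  have "b \<in> W_m m \<alpha> \<Omega>" unfolding b_def[abs_def] by (rule boundary_value_in_W_m[OF g(1) m h \<alpha> \<Omega>])
  then have "continuous_on \<Omega> b"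
    using \<alpha> by (auto simp: W_m_def intro: holder_on_imp_continuous_on)
  then have "continuous_on \<Omega> (\<lambda>x. Re (F x) - Re (b x))" by (intro continuous_intros F)
  then have "spline_approximable m h \<Omega> (\<lambda>x. of_real (Re (F x) - Re (b x)))"
    by (rule spline_approximable_continuous_real[OF m h \<Omega>])
  from spline_approximable_lincomb[OF spline_approximable_self[OF g(1)] this m h, of 1 1]
  have "spline_approximable m h \<Omega> (\<lambda>x. b x + of_real (Re (F x) - Re (b x)))"
    by (simp add: b_def)
  then have "\<exists>g'\<in>uniform_splines m h. \<forall>x\<in>\<Omega>.
      norm (boundary_value (cauchy_int g') (of_real x) - (b x + of_real (Re (F x) - Re (b x)))) \<le> e / 2"
    by (rule spline_approximable_def[THEN iffD1, THEN spec, THEN mp]) (simp add: e)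
  then obtain g' where g': "g' \<in> uniform_splines m h"
    "\<And>x. x \<in> \<Omega> \<Longrightarrow> norm (boundary_value (cauchy_int g') (of_real x) - (b x + of_real (Re (F x) - Re (b x)))) \<le> e / 2"
    by (elim bexE) metis
  have "norm (boundary_value (cauchy_int g') (of_real x) - F x) \<le> e" if x: "x \<in> \<Omega>" for x
  proof -
    define t where "t = Im (F x) / pi"
    have Im_F: "Im (F x) = pi * t" by (simp add: t_def)
    have "\<bar>g x - t\<bar> \<le> \<bar>g x - P x\<bar> + \<bar>t - P x\<bar>" by linarith
    also have "\<dots> \<le> d + d" using P(2)[OF x] g(2)[OF r[OF x]] by (intro add_mono) (simp_all add: t_def)
    finally have "pi * \<bar>g x - t\<bar> \<le> pi * (d + d)" by (rule mult_left_mono) simp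
    also have "pi * (d + d) = e / 2" by (simp add: d_def)
    also have "pi * \<bar>g x - t\<bar> = \<bar>pi * g x - Im (F x)\<bar>"
      unfolding Im_F right_diff_distrib[symmetric] abs_mult by simp
    finally have im: "\<bar>pi * g x - Im (F x)\<bar> \<le> e / 2" .
    have Im_b: "Im (b x) = pi * g x" unfolding b_def by (rule Im_boundary_value_cauchy_int[OF M R])
    \<comment> \<open>The corrected function has exactly the real part of \<open>F\<close>, so only
      the imaginary error of \<open>g\<close> remains.\<close>
    have "b x + of_real (Re (F x) - Re (b x)) - F x = \<i> * of_real (Im (b x) - Im (F x))"
      by (rule complex_eqI) simp_all
    then have "norm (b x + of_real (Re (F x) - Re (b x)) - F x) = \<bar>pi * g x - Im (F x)\<bar>"
      by (simp only: norm_mult norm_ii norm_of_real Im_b mult_1)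
    then have "norm (b x + of_real (Re (F x) - Re (b x)) - F x) \<le> e / 2"
      using im by (rule ord_eq_le_trans)
    then have "norm (boundary_value (cauchy_int g') (of_real x) - F x) \<le> e / 2 + e / 2"
      by (rule norm_diff_triangle_le[OF g'(2)[OF x]])
    then show ?thesis by (simp only: field_sum_of_halves)
  qed
  then show ?thesis
    by (intro bexI[OF _ boundary_value_in_W_m[OF g'(1) m h \<alpha> \<Omega>]]) (rule ballI)
qed

section \<open>Weighted Lp norms\<close>

lemma W_m_subset_W_alpha: "W_m m \<alpha> \<Omega> \<subseteq> W_alpha \<alpha> \<Omega>"
  unfolding W_m_def W_alpha_def by blast

text \<open>For finite \<open>p\<close> the norm is a \<open>powr\<close> value. For
  \<open>p = \<infinity>\<close> the essential supremum over a null space is \<open>top\<close> or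
  \<open>- \<infinity>\<close>, both of which \<open>real_of_ereal\<close> sends to
  \<open>0\<close>; on a space of positive measure it cannot be negative.\<close>

lemma Lp_norm_nonneg:
  assumes "1 \<le> p" "\<And>x. x \<in> \<Omega> \<Longrightarrow> w x \<ge> 0"
  shows "Lp_norm p w \<Omega> f \<ge> 0"
proof (cases "p = \<infinity>")
  case True
  let ?M = "restrict_space lborel \<Omega>" and ?f = "\<lambda>x. ereal (w x * cmod (f x))"
  have "real_of_ereal (esssup ?M ?f) \<ge> 0"
  proof (cases "emeasure ?M (space ?M) = 0")
    case zero: True
    have "esssup ?M ?f = top \<or> esssup ?M ?f = - \<infinity>"
      using esssup_zero_space[OF zero] esssup_non_measurable[of ?f ?M] by blast
    then show ?thesis by (auto simp: top_ereal_def)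
  next
    case False
    have "esssup ?M ?f \<ge> 0"
    proof (rule ccontr)
      assume "\<not> esssup ?M ?f \<ge> 0"
      then have neg: "esssup ?M ?f < 0" by simp
      have "AE x in ?M. x \<in> \<Omega>" by (auto simp: space_restrict_space)
      with esssup_AE[of ?f ?M] have "AE x in ?M. False"
      proof eventually_elim
        case (elim x)
        then have "0 \<le> ?f x" using assms(2) by simp
        with elim(1) neg show ?case by (meson leD order_trans)
      qed
      then show False using False ae_filter_eq_bot_iff[of ?M] trivial_limit_def by blast
    qed
    then show ?thesis by (simp add: real_of_ereal_pos)
  qed
  then show ?thesis using True by (simp add: Lp_norm_def)
qed (simp add: Lp_norm_def)

text \<open>Covers functions without any measurability: a nonmeasurable essential supremum is
  \<open>top\<close> and becomes \<open>0\<close>, and a nonexistent integral is \<open>0\<close>.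
  The absolute value of \<open>W\<close> allows for an empty \<open>\<Omega>\<close>, where
  \<open>W\<close> is unconstrained.\<close>

lemma Lp_norm_le_uniform:
  assumes p: "1 \<le> p" and \<Omega>: "compact \<Omega>" and w: "\<And>x. x \<in> \<Omega> \<Longrightarrow> 0 \<le> w x \<and> w x \<le> W"
  shows "\<exists>C\<ge>0. \<forall>f e. e > 0 \<longrightarrow> (\<forall>x\<in>\<Omega>. cmod (f x) \<le> e) \<longrightarrow> Lp_norm p w \<Omega> f \<le> C * e"
proof (cases "p = \<infinity>")
  case True
  have "Lp_norm p w \<Omega> f \<le> \<bar>W\<bar> * e" if e: "e > 0" "\<And>x. x \<in> \<Omega> \<Longrightarrow> cmod (f x) \<le> e" for f e
  proof -
    let ?M = "restrict_space lborel \<Omega>" and ?f = "\<lambda>x. ereal (w x * cmod (f x))"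
    have We: "\<bar>W\<bar> * e \<ge> 0" using e by simp
    have "real_of_ereal (esssup ?M ?f) \<le> \<bar>W\<bar> * e"
    proof (cases "?f \<in> borel_measurable ?M")
      case True
      have "w x * cmod (f x) \<le> \<bar>W\<bar> * e" if "x \<in> \<Omega>" for x
        using e(2)[OF that] w[OF that] by (intro mult_mono) auto
      then have "AE x in ?M. ?f x \<le> ereal (\<bar>W\<bar> * e)" by (intro AE_I2) (auto simp: space_restrict_space)
      then have "esssup ?M ?f \<le> ereal (\<bar>W\<bar> * e)" by (rule esssup_I[OF True])
      then show ?thesis using We by (cases "esssup ?M ?f") auto
    next
      case False
      then show ?thesis using We by (simp add: esssup_non_measurable top_ereal_def)
    qed
    then show ?thesis using True by (simp add: Lp_norm_def)
  qed
  then show ?thesis by (intro exI[of _ "\<bar>W\<bar>"]) auto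
next
  case False
  then obtain s where s: "p = ereal s" "s \<ge> 1" using p by (cases p) auto
  define \<mu> where "\<mu> = measure lborel \<Omega>"
  have "Lp_norm p w \<Omega> f \<le> (\<mu> * \<bar>W\<bar>) powr (1 / s) * e" if e: "e > 0" "\<And>x. x \<in> \<Omega> \<Longrightarrow> cmod (f x) \<le> e" for f e
  proof -
    let ?I = "LINT x:\<Omega>|lborel. w x * cmod (f x) powr s"
    have meas: "\<Omega> \<in> sets lborel" "emeasure lborel \<Omega> < \<infinity>"
      using \<Omega> emeasure_compact_finite by (auto intro: borel_compact)
    have I0: "?I \<ge> 0"
      unfolding set_lebesgue_integral_def using w by (intro Bochner_Integration.integral_nonneg) (auto simp: indicator_def)
    have "?I \<le> (LINT x|lborel. indicator \<Omega> x * (\<bar>W\<bar> * e powr s))"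
      unfolding set_lebesgue_integral_def
    \<comment> \<open>This form asks for integrability of the majorant only.\<close>
    proof (rule Bochner_Integration.integral_mono')
      show "integrable lborel (\<lambda>x. indicator \<Omega> x * (\<bar>W\<bar> * e powr s))"
        using meas by (intro integrable_mult_left) auto
      fix x
      show "indicator \<Omega> x *\<^sub>R (w x * cmod (f x) powr s) \<le> indicator \<Omega> x * (\<bar>W\<bar> * e powr s)"
        using e w[of x] s by (cases "x \<in> \<Omega>") (auto intro!: mult_mono powr_mono2)
      show "0 \<le> indicator \<Omega> x * (\<bar>W\<bar> * e powr s)" by simp
    qed
    also have "\<dots> = \<mu> * \<bar>W\<bar> * e powr s" using meas by (simp add: \<mu>_def)
    finally have "?I powr (1 / s) \<le> (\<mu> * \<bar>W\<bar> * e powr s) powr (1 / s)"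
      using I0 s by (intro powr_mono2) auto
    also have "\<dots> = (\<mu> * \<bar>W\<bar>) powr (1 / s) * e"
      using s e by (simp add: powr_mult powr_powr \<mu>_def)
    finally show ?thesis using s by (simp add: Lp_norm_def)
  qed
  then show ?thesis by (intro exI[of _ "(\<mu> * \<bar>W\<bar>) powr (1 / s)"]) auto
qed

section \<open>Equality of the two infima\<close>

lemma finite_union_closed_intervals_compact:
  "finite_union_closed_intervals \<Omega> \<Longrightarrow> compact \<Omega>"
  unfolding finite_union_closed_intervals_def by (auto intro!: compact_UN simp: case_prod_unfold)

theorem theorem4p2:
  fixes \<Omega> :: "real set" and w :: "real \<Rightarrow> real" and \<alpha> :: real and p :: ereal
    and m :: nat and F :: "real \<Rightarrow> complex"
  assumes "finite_union_closed_intervals \<Omega>"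
    and "continuous_on \<Omega> w" and "\<forall>x\<in>\<Omega>. w x > 0"
    and "0 < \<alpha>" and "\<alpha> < 1"
    and "1 \<le> p"
    and "m \<ge> 2"
    and "continuous_on \<Omega> F"
  shows "(INF q\<in>W_alpha \<alpha> \<Omega>. Lp_norm p w \<Omega> (\<lambda>x. q x - F x))
       = (INF q\<in>W_m m \<alpha> \<Omega>. Lp_norm p w \<Omega> (\<lambda>x. q x - F x))"
proof -
  have \<Omega>: "compact \<Omega>" by (rule finite_union_closed_intervals_compact[OF assms(1)])
  obtain W where W: "\<And>x. x \<in> \<Omega> \<Longrightarrow> \<bar>w x\<bar> \<le> W"
    using compact_imp_bounded[OF compact_continuous_image[OF assms(2) \<Omega>]] by (auto simp: bounded_real)
  have w: "0 \<le> w x \<and> w x \<le> W" if "x \<in> \<Omega>" for x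
    using assms(3) W[OF that] that by (auto simp: less_imp_le)
  define N where "N q = Lp_norm p w \<Omega> (\<lambda>x. q x - F x)" for q
  have N0: "N q \<ge> 0" for q unfolding N_def using w by (intro Lp_norm_nonneg assms) auto
  have "\<exists>C\<ge>0. \<forall>f e. e > 0 \<longrightarrow> (\<forall>x\<in>\<Omega>. cmod (f x) \<le> e) \<longrightarrow> Lp_norm p w \<Omega> f \<le> C * e"
    by (rule Lp_norm_le_uniform[OF assms(6) \<Omega> w])
  then obtain C where C: "C \<ge> 0"
      "\<forall>f e. e > 0 \<longrightarrow> (\<forall>x\<in>\<Omega>. cmod (f x) \<le> e) \<longrightarrow> Lp_norm p w \<Omega> f \<le> C * e"
    by (elim exE conjE)
  have small: "\<exists>q\<in>W_m m \<alpha> \<Omega>. N q < e" if e: "e > 0" for e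
  proof -
    define d where "d = e / (C + 1)"
    have d: "d > 0" using e C(1) by (simp add: d_def)
    obtain q where q: "q \<in> W_m m \<alpha> \<Omega>" "\<forall>x\<in>\<Omega>. norm (q x - F x) \<le> d"
      using W_m_uniformly_dense[OF assms(7,4,5) \<Omega> assms(8) d] by blast
    have "N q \<le> C * d" unfolding N_def by (rule C(2)[rule_format, OF d q(2)[rule_format]])
    also have "\<dots> < e" using e C(1) by (simp add: d_def field_simps)
    finally show ?thesis using q(1) by blast
  qed
  \<comment> \<open>Stated for any set that contains \<open>W_m\<close>, so that both sides of the
    claim are instances.\<close>
  have INF_0: "(INF q\<in>S. N q) = 0" if S: "W_m m \<alpha> \<Omega> \<subseteq> S" for S
  proof (rule antisym)
    have bdd: "bdd_below (N ` S)" using N0 by (intro bdd_belowI[of _ 0]) auto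
    show "(INF q\<in>S. N q) \<le> 0"
    proof (rule field_le_epsilon)
      fix e :: real assume "e > 0"
      then obtain q where "q \<in> W_m m \<alpha> \<Omega>" "N q < e" using small by blast
      then show "(INF q\<in>S. N q) \<le> 0 + e" using cINF_lower[OF bdd, of q] S by auto
    qed
    \<comment> \<open>\<open>small[of 1]\<close> supplies the nonemptiness of \<open>S\<close>,
      which the conditionally complete infimum needs.\<close>
    show "0 \<le> (INF q\<in>S. N q)" using small[of 1] S N0 by (intro cINF_greatest) auto
  qed
  show ?thesis
    unfolding N_def[symmetric] INF_0[OF order_refl] INF_0[OF W_m_subset_W_alpha] ..
qed

end
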